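(* Run Exp3-ISS with constant $\eta_j=\eta=\Theta\left(\frac{1}{N^{2/3}T^{1/3}}\right)$ and $\tau=\max\left(T^{1/3}N^{-1/3},\ \frac{\log(2\sqrt2\,\kappa)}{-\log\rho}\right)$ (rounded up to an integer). When $T\ge N$, $$\mathrm{PolicyRegret}\le\tilde O(N^{1/3}T^{2/3})+\exp(O(\mathbb M)),$$ where $\tilde O(\cdot)$ hides a $\log N$ factor, and the constants hidden in $\tilde O$ and $O$ do not depend on $N,T,\mathbb M$ (they may depend on $L_f,L_{c1},L_{c2},c_0,L_\pi,\kappa,\rho,\beta w_{\max},\|x_0\|,\bar\pi_0$ and the constants in the choice of $\eta$).
   Context: $\|\cdot\|$ is the Euclidean norm. System. $x_{t+1}=f(x_t,u_t,w_t)$ with $x_t\in\mathbb R^n$, $u_t\in\mathbb R^m$, $w_t\in\mathbb R^n$, $\|w_t\|\le w_{\max}$; the disturbance sequence is obliviously adversarial (does not depend on past states and actions). $f$ satisfies $\|f(x,u,w)-f(x',u',w')\|\le L_f(\|x-x'\|+\|u-u'\|+\|w-w'\|)$ and $f(0,0,0)=0$. Candidate controllers. $\pi_1,\dots,\pi_N:\mathbb R^n\to\mathbb R^m$, $\mathcal P_0=\{1,\dots,N\}$; each $\pi_i$ is $L_\pi$-Lipschitz and $\max_i\|\pi_i(0)\|\le\bar\pi_0$. Parameters $\kappa\ge1$, $\rho\in(0,1)$, $\beta\ge 1$ are given, and $L_f\ge1$, $L_\pi\ge1$. - A controller $\pi$ is E-ISS with parameters $(\kappa,\rho,\beta)$ if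 for every $x_0$ and every sequence with $\|w_t\|\le w_{\max}$ for all $t$, the trajectory $x_{t+1}=f(x_t,\pi(x_t),w_t)$ satisfies $\|x_t\|\le\kappa\rho^t\|x_0\|+\beta w_{\max}$ for all $t\ge 0$. - $\pi$ is $\delta$-ES with parameters $(\kappa,\rho)$ if any two trajectories $x_{t+1}=f(x_t,\pi(x_t),w_t)$, $y_{t+1}=f(y_t,\pi(y_t),w_t)$ driven by the same disturbances (with $\|w_s\|\le w_{\max}$) satisfy $\|x_t-y_t\|\le\kappa\rho^t\|x_0-y_0\|$. $\mathcal B\subseteq\mathcal P_0$ is the set of $i$ such that $\pi_i$ is both E-ISS with parameters $(\kappa,\rho,\beta)$ and $\delta$-ES with parameters $(\kappa,\rho)$; it is assumed nonempty. $\mathbb M$ is the number of candidate controllers that are not E-ISS with parameters $(\kappa,\rho,\beta)$. Costs. Unknown time-varying functions $c_t(x,u)$ satisfying $|c_t(x,u)-c_t(x',u')|\le (L_{c1}(\max(\|x\|,\|x'\|)+\max(\|u\|,\|u'\|))+L_{c2})(\|x-x'\|+\|u-u'\|)$ and $0\le c_t(0,0)\le c_0$. Algorithm Exp3-ISS. Inputs: non-increasing $(\eta_j)_{j\ge0}$, an integer $\tau\ge1$, $\kappa,\rho,\beta$. Set $t_0=0$, $\tilde G_{-1}(i)=0$ for all $i$, $p_0$ uniform on $\mathcal P_0$. For batches $j=0,1,2,\dots$: draw $I_j\sim p_j$ from the active set $\mathcal P_j$ (terminate if $\mathcal P_j=\emptyset$) and initialize $\mathcal P_{j+1}=\mathcal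 P_j$. For $t=t_j,\dots,\min(t_j+\tau-1,T)$: apply $u_t=\pi_{I_j}(x_t)$ and observe $x_{t+1}$ and $c_t(x_t,u_t)$; if $\|x_{t+1}\|>\kappa\rho^{t+1-t_j}\|x_{t_j}\|+\beta w_{\max}$, set $\mathcal P_{j+1}=\mathcal P_j\setminus\{I_j\}$ and end the batch immediately ("Break"). With $t$ the last stage of the batch, set $t_{j+1}=t+1$. Let $g_j=\frac1\tau\sum_{t=t_j}^{t_{j+1}-1}c_t(x_t,u_t)$, $\tilde g_j(i)=\frac{g_j}{p_j(i)}\mathbf 1_{(I_j=i)}$, $\tilde G_j(i)=\tilde G_{j-1}(i)+\tilde g_j(i)$ for $i\in\mathcal P_{j+1}$, and $p_{j+1}(i)=\exp(-\eta_j\tilde G_j(i))/\sum_{k\in\mathcal P_{j+1}}\exp(-\eta_j\tilde G_j(k))$ for $i\in\mathcal P_{j+1}$. The run ends after stage $T$. Policy regret. For an algorithm (or a fixed controller) generating $(x_t,u_t)$ from initial state $x_0$, its total cost is $J_T=\sum_{t=0}^Tc_t(x_t,u_t)$. $\mathrm{PolicyRegret}=\mathbb E\,J_T(\text{Exp3-ISS})-\min_{i\in\mathcal B}J_T(\pi_i)$, where the expectation is over the random selections $(I_j)$ and $J_T(\pi_i)$ is the cost of using $\pi_i$ at all stages, from the same $x_0$ with the same disturbances and costs.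
   Formalization: The costs are assumed nonnegative, c_t(x,u) ≥ 0 for all x and u, rather than only 0 ≤ c_t(0,0); for signed costs such as c_t = -|u| with two constant controllers the stated bound fails. *)

theory Defs
  imports "HOL-Probability.Probability"
begin

text \<open>
  The spaces \<open>\<real>\<^sup>n\<close> and \<open>\<real>\<^sup>m\<close> are the carriers of the library topology \<^const>\<open>Euclidean_space\<close>, i.e. the
  sequences that vanish from index \<open>n\<close> (resp. \<open>m\<close>) on. The dimensions are thus ordinary
  natural numbers, and constants can be asserted to be independent of them.
\<close>

type_synonym rvec = "nat \<Rightarrow> real"

abbreviation Rn :: "nat \<Rightarrow> rvec set" where
  "Rn n \<equiv> topspace (Euclidean_space n)"

definition enorm :: "nat \<Rightarrow> rvec \<Rightarrow> real" where
  "enorm n x = L2_set x {..<n}"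

definition edist :: "nat \<Rightarrow> rvec \<Rightarrow> rvec \<Rightarrow> real" where
  "edist n x y = enorm n (\<lambda>i. x i - y i)"

abbreviation rzero :: rvec where
  "rzero \<equiv> (\<lambda>_. 0)"

text \<open>
  \<open>closed_loop f p w s x k\<close> is the state reached from state \<open>x\<close> at stage \<open>s\<close> after applying
  the controller \<open>p\<close> at the \<open>k\<close> stages \<open>s, \<dots>, s + k - 1\<close>.
\<close>

primrec closed_loop ::
  "(rvec \<Rightarrow> rvec \<Rightarrow> rvec \<Rightarrow> rvec) \<Rightarrow> (rvec \<Rightarrow> rvec) \<Rightarrow> (nat \<Rightarrow> rvec) \<Rightarrow> nat \<Rightarrow> rvec \<Rightarrow> nat \<Rightarrow> rvec" where
  "closed_loop f p w s x 0 = x"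
| "closed_loop f p w s x (Suc k) =
     f (closed_loop f p w s x k) (p (closed_loop f p w s x k)) (w (s + k))"

definition disturbances :: "nat \<Rightarrow> real \<Rightarrow> (nat \<Rightarrow> rvec) set" where
  "disturbances n wmax = {w. \<forall>t. w t \<in> Rn n \<and> enorm n (w t) \<le> wmax}"

definition E_ISS ::
  "nat \<Rightarrow> (rvec \<Rightarrow> rvec \<Rightarrow> rvec \<Rightarrow> rvec) \<Rightarrow> real \<Rightarrow> real \<Rightarrow> real \<Rightarrow> real \<Rightarrow> (rvec \<Rightarrow> rvec) \<Rightarrow> bool" where
  "E_ISS n f wmax \<kappa> \<rho> \<beta> p \<longleftrightarrow>
     (\<forall>x\<in>Rn n. \<forall>w\<in>disturbances n wmax. \<forall>t.
        enorm n (closed_loop f p w 0 x t) \<le> \<kappa> * \<rho> ^ t * enorm n x + \<beta> * wmax)"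

definition delta_ES ::
  "nat \<Rightarrow> (rvec \<Rightarrow> rvec \<Rightarrow> rvec \<Rightarrow> rvec) \<Rightarrow> real \<Rightarrow> real \<Rightarrow> real \<Rightarrow> (rvec \<Rightarrow> rvec) \<Rightarrow> bool" where
  "delta_ES n f wmax \<kappa> \<rho> p \<longleftrightarrow>
     (\<forall>x\<in>Rn n. \<forall>y\<in>Rn n. \<forall>w\<in>disturbances n wmax. \<forall>t.
        edist n (closed_loop f p w 0 x t) (closed_loop f p w 0 y t) \<le> \<kappa> * \<rho> ^ t * edist n x y)"

text \<open>
  The state of the algorithm at the start of batch \<open>j\<close>: the stage \<open>t\<^sub>j\<close>, the plant state at
  that stage, \<open>j\<close> itself, the active set, the cumulative estimates (through batch \<open>j - 1\<close>), the
  distribution \<open>p\<^sub>j\<close>, and the cost \<open>\<Sum>t<t\<^sub>j. c\<^sub>t(x\<^sub>t, u\<^sub>t)\<close> incurred so far.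
\<close>

record exp3_state =
  stage_of :: nat
  plant_of :: rvec
  batch_of :: nat
  active_of :: "nat set"
  estimate_of :: "nat \<Rightarrow> real"
  sampler_of :: "nat pmf"
  cost_of :: real

text \<open>Meaningful for finite nonempty \<open>A\<close> only; the algorithm stops when the active set is empty.\<close>

definition exp_weights :: "real \<Rightarrow> (nat \<Rightarrow> real) \<Rightarrow> nat set \<Rightarrow> nat pmf" where
  "exp_weights \<eta> G A =
     embed_pmf (\<lambda>i. if i \<in> A then exp (- \<eta> * G i) / (\<Sum>k\<in>A. exp (- \<eta> * G k)) else 0)"

text \<open>
  The disturbances \<open>w\<close> and the costs \<open>c\<close> are fixed sequences, chosen before any random
  selection is made: the adversary is oblivious. The costs are nonnegative; exponential weights
  without explicit exploration do not have sublinear regret for signed costs.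
\<close>

locale switching_control =
  fixes n m :: nat
    and f :: "rvec \<Rightarrow> rvec \<Rightarrow> rvec \<Rightarrow> rvec"
    and N :: nat
    and \<pi> :: "nat \<Rightarrow> rvec \<Rightarrow> rvec"
    and wmax \<kappa> \<rho> \<beta> :: real
    and w :: "nat \<Rightarrow> rvec"
    and c :: "nat \<Rightarrow> rvec \<Rightarrow> rvec \<Rightarrow> real"
    and x0 :: rvec
    and Lf L\<pi> \<pi>bar Lc1 Lc2 c0 :: real
  assumes Lf: "Lf \<ge> 1" and L\<pi>: "L\<pi> \<ge> 1"
    and \<kappa>: "\<kappa> \<ge> 1" and \<rho>: "0 < \<rho>" "\<rho> < 1" and \<beta>: "\<beta> \<ge> 1"
    and f_closed: "\<lbrakk>x \<in> Rn n; u \<in> Rn m; v \<in> Rn n\<rbrakk> \<Longrightarrow> f x u v \<in> Rn n"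
    and f_lipschitz:
      "\<lbrakk>x \<in> Rn n; x' \<in> Rn n; u \<in> Rn m; u' \<in> Rn m; v \<in> Rn n; v' \<in> Rn n\<rbrakk> \<Longrightarrow>
        edist n (f x u v) (f x' u' v') \<le> Lf * (edist n x x' + edist m u u' + edist n v v')"
    and f_zero: "f rzero rzero rzero = rzero"
    and w: "w \<in> disturbances n wmax"
    and x0: "x0 \<in> Rn n"
    and \<pi>_closed: "\<lbrakk>i \<in> {1..N}; x \<in> Rn n\<rbrakk> \<Longrightarrow> \<pi> i x \<in> Rn m"
    and \<pi>_lipschitz:
      "\<lbrakk>i \<in> {1..N}; x \<in> Rn n; x' \<in> Rn n\<rbrakk> \<Longrightarrow> edist m (\<pi> i x) (\<pi> i x') \<le> L\<pi> * edist n x x'"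
    and \<pi>_zero: "i \<in> {1..N} \<Longrightarrow> enorm m (\<pi> i rzero) \<le> \<pi>bar"
    and c_nonneg: "\<lbrakk>x \<in> Rn n; u \<in> Rn m\<rbrakk> \<Longrightarrow> 0 \<le> c t x u"
    and c_lipschitz:
      "\<lbrakk>x \<in> Rn n; x' \<in> Rn n; u \<in> Rn m; u' \<in> Rn m\<rbrakk> \<Longrightarrow>
        \<bar>c t x u - c t x' u'\<bar> \<le>
          (Lc1 * (max (enorm n x) (enorm n x') + max (enorm m u) (enorm m u')) + Lc2)
            * (edist n x x' + edist m u u')"
    and c_zero: "0 \<le> c t rzero rzero" "c t rzero rzero \<le> c0"
    and benign_nonempty:
      "{i \<in> {1..N}. E_ISS n f wmax \<kappa> \<rho> \<beta> (\<pi> i) \<and> delta_ES n f wmax \<kappa> \<rho> (\<pi> i)} \<noteq> {}"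
begin

definition benign :: "nat set" where
  "benign = {i \<in> {1..N}. E_ISS n f wmax \<kappa> \<rho> \<beta> (\<pi> i) \<and> delta_ES n f wmax \<kappa> \<rho> (\<pi> i)}"

definition num_not_E_ISS :: nat where
  "num_not_E_ISS = card {i \<in> {1..N}. \<not> E_ISS n f wmax \<kappa> \<rho> \<beta> (\<pi> i)}"

definition controller_cost :: "nat \<Rightarrow> nat \<Rightarrow> real" where
  "controller_cost T i =
     (\<Sum>t\<le>T. c t (closed_loop f (\<pi> i) w 0 x0 t) (\<pi> i (closed_loop f (\<pi> i) w 0 x0 t)))"

text \<open>The stability test on the state reached \<open>k\<close> stages after the start \<open>(s, x)\<close> of a batch.\<close>

definition violates :: "nat \<Rightarrow> nat \<Rightarrow> rvec \<Rightarrow> nat \<Rightarrow> bool" where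
  "violates i s x k \<longleftrightarrow>
     enorm n (closed_loop f (\<pi> i) w s x k) > \<kappa> * \<rho> ^ k * enorm n x + \<beta> * wmax"

text \<open>
  The number of stages of the batch: it ends at the first \<open>k \<ge> 1\<close> such that \<open>\<tau>\<close> stages have been
  played, stage \<open>T\<close> has been played, or the test fails.
\<close>

definition batch_length :: "nat \<Rightarrow> nat \<Rightarrow> nat \<Rightarrow> nat \<Rightarrow> rvec \<Rightarrow> nat" where
  "batch_length \<tau> T i s x = (LEAST k. 0 < k \<and> (k = \<tau> \<or> T < s + k \<or> violates i s x k))"

definition play_batch ::
  "(nat \<Rightarrow> real) \<Rightarrow> nat \<Rightarrow> nat \<Rightarrow> exp3_state \<Rightarrow> nat \<Rightarrow> exp3_state" where
  "play_batch \<eta> \<tau> T S i =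
     (let s = stage_of S;
          x = plant_of S;
          traj = closed_loop f (\<pi> i) w s x;
          len = batch_length \<tau> T i s x;
          A = (if violates i s x len then active_of S - {i} else active_of S);
          batch_cost = (\<Sum>k<len. c (s + k) (traj k) (\<pi> i (traj k)));
          g = batch_cost / real \<tau>;
          G = (\<lambda>k. estimate_of S k + (if k = i then g / pmf (sampler_of S) k else 0))
      in \<lparr>stage_of = s + len,
          plant_of = traj len,
          batch_of = Suc (batch_of S),
          active_of = A,
          estimate_of = G,
          sampler_of = exp_weights (\<eta> (batch_of S)) G A,
          cost_of = cost_of S + batch_cost\<rparr>)"

definition exp3_iss_batch ::
  "(nat \<Rightarrow> real) \<Rightarrow> nat \<Rightarrow> nat \<Rightarrow> exp3_state \<Rightarrow> exp3_state pmf" where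
  "exp3_iss_batch \<eta> \<tau> T S =
     (if T < stage_of S \<or> active_of S = {} then return_pmf S
      else map_pmf (play_batch \<eta> \<tau> T S) (sampler_of S))"

primrec exp3_iss :: "(nat \<Rightarrow> real) \<Rightarrow> nat \<Rightarrow> nat \<Rightarrow> nat \<Rightarrow> exp3_state pmf" where
  "exp3_iss \<eta> \<tau> T 0 = return_pmf
     \<lparr>stage_of = 0, plant_of = x0, batch_of = 0, active_of = {1..N}, estimate_of = (\<lambda>_. 0),
      sampler_of = pmf_of_set {1..N}, cost_of = 0\<rparr>"
| "exp3_iss \<eta> \<tau> T (Suc j) = bind_pmf (exp3_iss \<eta> \<tau> T j) (exp3_iss_batch \<eta> \<tau> T)"

text \<open>
  Every batch plays at least one of the stages \<open>0, \<dots>, T\<close>, so the run is over after at most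
  \<open>T + 1\<close> batches; later batches do not change the state.
\<close>

definition exp3_iss_cost :: "(nat \<Rightarrow> real) \<Rightarrow> nat \<Rightarrow> nat \<Rightarrow> real" where
  "exp3_iss_cost \<eta> \<tau> T = measure_pmf.expectation (exp3_iss \<eta> \<tau> T (Suc T)) cost_of"

definition policy_regret :: "(nat \<Rightarrow> real) \<Rightarrow> nat \<Rightarrow> nat \<Rightarrow> real" where
  "policy_regret \<eta> \<tau> T = exp3_iss_cost \<eta> \<tau> T - (MIN i\<in>benign. controller_cost T i)"

end

definition batch_parameter :: "real \<Rightarrow> real \<Rightarrow> nat \<Rightarrow> nat \<Rightarrow> nat" where
  "batch_parameter \<kappa> \<rho> N T =
     nat \<lceil>max (real T powr (1/3) * real N powr (-1/3)) (ln (2 * sqrt 2 * \<kappa>) / (- ln \<rho>))\<rceil>"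

end

theory Submission
  imports Defs
begin

text \<open>
  Fix the best benign controller \<open>i\<^sup>*\<close>. Each batch is one round of EXP3 with importance-weighted
  losses, where the loss of arm \<open>i\<close> is the cost that the batch would incur if \<open>i\<close> were drawn in
  the current plant state. Three facts turn a bound for EXP3 into a bound on policy regret.

  \<^item> \<^emph>\<open>The loss of \<open>i\<^sup>*\<close> in a batch is close to its true cost.\<close> Restarting \<open>i\<^sup>*\<close> in the state that
    the algorithm has reached, instead of the one that \<open>i\<^sup>*\<close> itself would have reached, costs only
    a geometric sum, because trajectories of a \<open>\<delta>\<close>-ES controller merge exponentially fast
    (\<open>batch_sum_benign_le\<close>).

  \<^item> \<^emph>\<open>The state explodes rarely.\<close> A controller that fails the stability test is not E-ISS and is
    removed, so this happens at most \<open>\<bbbM>\<close> times, and by the Lipschitz bounds each failure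
    multiplies \<open>1 + \<parallel>x\<parallel>\<close> by at most a constant. A batch that passes the test and has full length
    contracts the state, as \<open>\<kappa> \<rho>\<^sup>\<tau> \<le> 1 / (2 \<surd>2)\<close>. Hence the fourth powers of the states at
    batch starts add up to a constant per batch plus \<open>exp (O(\<bbbM>))\<close>. Costs grow quadratically
    and EXP3 squares the losses, which is why fourth powers are the ones that matter
    (\<open>burst_left_play\<close>).

  \<^item> \<^emph>\<open>There are few batches,\<close> at most \<open>(T + 1) / \<tau> + 1 + \<bbbM>\<close> (\<open>batches_left_play\<close>).

  All of this is bookkeeping along one Markov chain. The potential \<open>regret_potential\<close> of a state is
  the EXP3 potential (cost so far, plus \<open>\<tau>\<close> times the logarithmic total weight and the estimate of
  \<open>i\<^sup>*\<close>) plus a budget that pays for the expected loss terms of all the batches to come. It does not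
  increase in expectation (\<open>regret_potential_play\<close>), and at any time it is at least the cost so far minus
  the full cost of \<open>i\<^sup>*\<close> (\<open>cost_le_regret_potential\<close>). Its initial value is therefore a bound
  for the regret (\<open>regret_le\<close>):
  \<open>\<tau> ln N / \<eta> + O(\<tau> \<bbbM> + \<bbbM> + T / \<tau> + 1) + exp (O(\<bbbM>))\<close>.
  The remaining second-order factor of EXP3, \<open>\<tau> \<eta> N\<close>, is bounded for the prescribed \<open>\<tau>\<close> and
  \<open>\<eta>\<close>, and inserting these values gives the rate. All constants are explicit functions of the
  parameters on which they may depend.
\<close>

section \<open>Supermartingales along a randomized recursion\<close>

lemma expectation_bind_pmf_le:
  fixes h :: "'a \<Rightarrow> real"
  assumes fin: "finite (set_pmf p)" "\<And>x. x \<in> set_pmf p \<Longrightarrow> finite (set_pmf (K x))"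
    and drift: "\<And>x. x \<in> set_pmf p \<Longrightarrow> measure_pmf.expectation (K x) h \<le> h x"
  shows "measure_pmf.expectation (p \<bind> K) h \<le> measure_pmf.expectation p h"
proof -
  have "measure_pmf.expectation (p \<bind> K) h =
      (\<Sum>a\<in>set_pmf p. pmf p a *\<^sub>R measure_pmf.expectation (K a) h)"
    by (rule pmf_expectation_bind) (use fin in auto)
  also have "\<dots> \<le> (\<Sum>a\<in>set_pmf p. pmf p a *\<^sub>R h a)"
    by (intro sum_mono) (auto intro!: mult_left_mono drift)
  also have "\<dots> = measure_pmf.expectation p h"
    using fin by (subst integral_measure_pmf[of "set_pmf p"]) auto
  finally show ?thesis .
qed

section \<open>Exponential weights\<close>

lemma exp_minus_le_quadratic:
  fixes z :: real
  assumes "0 \<le> z"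
  shows "exp (- z) \<le> 1 - z + z\<^sup>2 / 2"
proof -
  have pos: "0 < 1 + z + z\<^sup>2 / 2"
    using assms by (simp add: add_pos_nonneg)
  have "exp (- z) \<le> 1 / (1 + z + z\<^sup>2 / 2)"
    using exp_lower_Taylor_quadratic[OF assms] pos by (simp add: exp_minus field_simps)
  also have "\<dots> \<le> 1 - z + z\<^sup>2 / 2"
  proof -
    have "1 \<le> 1 + z ^ 4 / 4"
      by simp
    also have "\<dots> = (1 - z + z\<^sup>2 / 2) * (1 + z + z\<^sup>2 / 2)"
      by (simp add: power2_eq_square power4_eq_xxxx algebra_simps)
    finally show ?thesis
      using pos by (simp add: divide_le_eq)
  qed
  finally show ?thesis .
qed

lemma
  assumes "finite A" "A \<noteq> {}"
  shows pmf_exp_weights: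
      "pmf (exp_weights \<eta> G A) i =
        (if i \<in> A then exp (- \<eta> * G i) / (\<Sum>k\<in>A. exp (- \<eta> * G k)) else 0)"
    and set_pmf_exp_weights: "set_pmf (exp_weights \<eta> G A) = A"
proof -
  let ?q = "\<lambda>i. if i \<in> A then exp (- \<eta> * G i) / (\<Sum>k\<in>A. exp (- \<eta> * G k)) else 0"
  have W: "0 < (\<Sum>k\<in>A. exp (- \<eta> * G k))"
    using assms by (intro sum_pos) auto
  have nonneg: "0 \<le> ?q i" for i
    using W by (auto simp: less_imp_le)
  have "(\<integral>\<^sup>+i. ennreal (?q i) \<partial>count_space UNIV) = (\<Sum>i\<in>A. ennreal (?q i))"
    using assms by (intro nn_integral_count_space'[THEN trans] sum.cong) auto
  also have "\<dots> = ennreal (\<Sum>i\<in>A. ?q i)"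
    by (rule sum_ennreal) (rule nonneg)
  also have "(\<Sum>i\<in>A. ?q i) = 1"
    using W by (simp flip: sum_divide_distrib)
  finally have total: "(\<integral>\<^sup>+i. ennreal (?q i) \<partial>count_space UNIV) = 1"
    by simp
  show "pmf (exp_weights \<eta> G A) i = ?q i"
    unfolding exp_weights_def by (rule pmf_embed_pmf[OF nonneg total])
  show "set_pmf (exp_weights \<eta> G A) = A"
    unfolding exp_weights_def using W by (subst set_embed_pmf[OF nonneg total]) auto
qed

lemma exp_weights_zero:
  assumes "finite A" "A \<noteq> {}"
  shows "exp_weights \<eta> (\<lambda>_. 0) A = pmf_of_set A"
  using assms by (intro pmf_eqI) (simp add: pmf_exp_weights indicator_def)

text \<open>The soft minimum of \<open>G\<close> over \<open>A\<close>, negated and not normalized by the size of \<open>A\<close>.\<close>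

definition log_weight :: "real \<Rightarrow> (nat \<Rightarrow> real) \<Rightarrow> nat set \<Rightarrow> real" where
  "log_weight \<eta> G A = ln (\<Sum>k\<in>A. exp (- \<eta> * G k)) / \<eta>"

lemma log_weight_zero:
  assumes "finite A"
  shows "log_weight \<eta> (\<lambda>_. 0) A = ln (real (card A)) / \<eta>"
  by (simp add: log_weight_def)

lemma log_weight_ge:
  assumes "finite A" "i \<in> A" "0 < \<eta>"
  shows "- G i \<le> log_weight \<eta> G A"
proof -
  have "exp (- \<eta> * G i) \<le> (\<Sum>k\<in>A. exp (- \<eta> * G k))"
    using assms by (intro member_le_sum) auto
  then have "- \<eta> * G i \<le> ln (\<Sum>k\<in>A. exp (- \<eta> * G k))"
    by (smt (verit) exp_gt_zero ln_exp ln_mono)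
  then show ?thesis
    using assms by (simp add: log_weight_def field_simps)
qed

text \<open>
  One EXP3 update, on every outcome: restricting to \<open>A'\<close> only removes weight, and what is left is
  the second-order expansion of the exponential. The first-order term is exactly \<open>g\<close>, because the
  importance weight \<open>1 / p\<close> cancels the probability of the arm whose estimate changes.
\<close>

lemma log_weight_importance_weighted_step:
  fixes G :: "nat \<Rightarrow> real"
  assumes A: "finite A" "i \<in> A" "A' \<subseteq> A" "A' \<noteq> {}" and \<eta>: "0 < \<eta>" and g: "0 \<le> g"
  defines "p \<equiv> pmf (exp_weights \<eta> G A) i"
  shows "log_weight \<eta> (\<lambda>k. G k + (if k = i then g / pmf (exp_weights \<eta> G A) k else 0)) A'
    \<le> log_weight \<eta> G A - g + \<eta> / 2 * (g\<^sup>2 / p)"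
proof -
  define W where "W = (\<Sum>k\<in>A. exp (- \<eta> * G k))"
  define G' where "G' = (\<lambda>k. G k + (if k = i then g / p else 0))"
  have W: "0 < W"
    unfolding W_def using A by (intro sum_pos) auto
  have p: "p = exp (- \<eta> * G i) / W"
    unfolding p_def W_def using A by (subst pmf_exp_weights) auto
  then have p0: "0 < p"
    using W by simp
  define z where "z = \<eta> * g / p"
  have z0: "0 \<le> z"
    using p0 \<eta> g by (simp add: z_def)
  have "(\<Sum>k\<in>A'. exp (- \<eta> * G' k)) \<le> (\<Sum>k\<in>A. exp (- \<eta> * G' k))"
    using A by (intro sum_mono2) auto
  also have "\<dots> = (\<Sum>k\<in>A - {i}. exp (- \<eta> * G k)) + exp (- \<eta> * G i) * exp (- z)"
    using A by (subst sum.remove[of A i])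
      (auto simp: G'_def z_def algebra_simps simp flip: exp_add)
  also have "\<dots> = W - exp (- \<eta> * G i) * (1 - exp (- z))"
    using A by (simp add: W_def sum.remove[of A i] algebra_simps)
  also have "\<dots> = W * (1 - p * (1 - exp (- z)))"
    using W by (simp add: p field_simps)
  also have "\<dots> \<le> W * (1 - p * (z - z\<^sup>2 / 2))"
    using W p0 exp_minus_le_quadratic[OF z0] by simp
  also have "\<dots> \<le> W * exp (- (p * (z - z\<^sup>2 / 2)))"
    using W exp_ge_add_one_self[of "- (p * (z - z\<^sup>2 / 2))"] by simp
  finally have le: "(\<Sum>k\<in>A'. exp (- \<eta> * G' k)) \<le> W * exp (- (p * (z - z\<^sup>2 / 2)))" .
  have fin': "finite A'"
    using A finite_subset by blast
  have "0 < (\<Sum>k\<in>A'. exp (- \<eta> * G' k))"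
    using A fin' by (intro sum_pos) auto
  then have "ln (\<Sum>k\<in>A'. exp (- \<eta> * G' k)) \<le> ln (W * exp (- (p * (z - z\<^sup>2 / 2))))"
    using le by (intro ln_mono) auto
  also have "\<dots> = ln W - p * (z - z\<^sup>2 / 2)"
    using W by (simp add: ln_mult)
  finally have "ln (\<Sum>k\<in>A'. exp (- \<eta> * G' k)) / \<eta> \<le> (ln W - p * (z - z\<^sup>2 / 2)) / \<eta>"
    using \<eta> by (intro divide_right_mono) auto
  also have "\<dots> = ln W / \<eta> - g + \<eta> / 2 * (g\<^sup>2 / p)"
    using p0 \<eta> by (simp add: z_def field_simps power2_eq_square)
  also have "G' = (\<lambda>k. G k + (if k = i then g / pmf (exp_weights \<eta> G A) k else 0))"
    by (auto simp: G'_def p_def)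
  finally show ?thesis
    by (simp add: log_weight_def W_def)
qed

section \<open>Norms and closed-loop trajectories\<close>

lemma enorm_nonneg [simp]: "0 \<le> enorm n x"
  by (simp add: enorm_def)

lemma edist_nonneg [simp]: "0 \<le> edist n x y"
  by (simp add: edist_def)

lemma enorm_rzero [simp]: "enorm n rzero = 0"
  by (simp add: enorm_def L2_set_def)

lemma edist_rzero [simp]: "edist n x rzero = enorm n x"
  by (simp add: edist_def)

lemma enorm_diff_le: "enorm n (\<lambda>i. x i - y i) \<le> enorm n x + enorm n y"
  using L2_set_triangle_ineq[of x "\<lambda>i. - y i" "{..<n}"] by (simp add: enorm_def L2_set_def)

lemma edist_le_enorm_add: "edist n x y \<le> enorm n x + enorm n y"
  unfolding edist_def by (rule enorm_diff_le)

lemma enorm_le_enorm_add_edist: "enorm n x \<le> enorm n y + edist n x y"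
  using L2_set_triangle_ineq[of y "\<lambda>i. x i - y i" "{..<n}"] by (simp add: edist_def enorm_def)

lemma rzero_in_Rn [simp]: "rzero \<in> Rn n"
  by (simp add: topspace_Euclidean_space)

lemma closed_loop_shift: "closed_loop f p w s x k = closed_loop f p (\<lambda>t. w (s + t)) 0 x k"
  by (induction k) auto

lemma closed_loop_add:
  "closed_loop f p w s x (k + l) = closed_loop f p w (s + k) (closed_loop f p w s x k) l"
  by (induction l) (auto simp: add.assoc)

section \<open>Growth of controls, costs and states\<close>

text \<open>
  Constants of the analysis. They take the real parameters of the problem as arguments, which makes
  it visible that they do not depend on the dimensions, on \<open>N\<close> or on \<open>T\<close>. In \<open>state_gain\<close>,
  \<open>W\<close> stands for \<open>\<beta> w\<^sub>m\<^sub>a\<^sub>x\<close>, and \<open>\<kappa> r\<^sub>0 + W\<close> is the radius of a ball which an E-ISS trajectory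
  from a state of norm \<open>r\<^sub>0\<close> does not leave; the other summands are coarse, so that one number
  serves all estimates.
\<close>

definition control_gain :: "real \<Rightarrow> real \<Rightarrow> real" where
  "control_gain L\<pi> \<pi>bar = 1 + L\<pi> + \<bar>\<pi>bar\<bar>"

definition cost_gain :: "real \<Rightarrow> real \<Rightarrow> real \<Rightarrow> real \<Rightarrow> real \<Rightarrow> real" where
  "cost_gain L\<pi> \<pi>bar Lc1 Lc2 c0 = (\<bar>Lc1\<bar> + \<bar>Lc2\<bar> + \<bar>c0\<bar>) * (control_gain L\<pi> \<pi>bar)\<^sup>2"

definition state_gain :: "real \<Rightarrow> real \<Rightarrow> real \<Rightarrow> real" where
  "state_gain \<kappa> W r0 = 1 + \<kappa> + W + (\<kappa> * r0 + W)"

context switching_control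
begin

abbreviation control_const :: real where
  "control_const \<equiv> control_gain L\<pi> \<pi>bar"

abbreviation cost_const :: real where
  "cost_const \<equiv> cost_gain L\<pi> \<pi>bar Lc1 Lc2 c0"

abbreviation state_const :: real where
  "state_const \<equiv> state_gain \<kappa> (\<beta> * wmax) (enorm n x0)"

lemma wmax_nonneg: "0 \<le> wmax"
proof -
  have "enorm n (w 0) \<le> wmax"
    using w by (simp add: disturbances_def)
  with enorm_nonneg show ?thesis
    by (rule order_trans)
qed

lemma wmax_le: "wmax \<le> \<beta> * wmax" and W_nonneg: "0 \<le> \<beta> * wmax"
  using mult_right_mono[OF \<beta> wmax_nonneg] wmax_nonneg by auto

lemma control_const_ge: "2 \<le> control_const" "L\<pi> + 1 \<le> control_const"
  using L\<pi> by (auto simp: control_gain_def)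

lemma cost_const_nonneg: "0 \<le> cost_const"
  by (simp add: cost_gain_def)

lemma state_const_ge: "2 \<le> state_const" "\<beta> * wmax \<le> state_const"
proof -
  have "0 \<le> \<kappa> * enorm n x0"
    using \<kappa> by simp
  then show "2 \<le> state_const" "\<beta> * wmax \<le> state_const"
    using \<kappa> W_nonneg unfolding state_gain_def by linarith+
qed

lemma closed_loop_in_Rn:
  assumes "i \<in> {1..N}" "x \<in> Rn n"
  shows "closed_loop f (\<pi> i) w s x k \<in> Rn n"
  using assms w by (induction k) (auto intro!: f_closed \<pi>_closed simp: disturbances_def)

lemma shifted_disturbances: "(\<lambda>t. w (s + t)) \<in> disturbances n wmax"
  using w by (auto simp: disturbances_def)

lemma E_ISS_closed_loop:
  assumes "E_ISS n f wmax \<kappa> \<rho> \<beta> (\<pi> i)" "x \<in> Rn n"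
  shows "enorm n (closed_loop f (\<pi> i) w s x k) \<le> \<kappa> * \<rho> ^ k * enorm n x + \<beta> * wmax"
  using assms shifted_disturbances unfolding closed_loop_shift[of f "\<pi> i" w s] E_ISS_def by blast

lemma delta_ES_closed_loop:
  assumes "delta_ES n f wmax \<kappa> \<rho> (\<pi> i)" "x \<in> Rn n" "y \<in> Rn n"
  shows "edist n (closed_loop f (\<pi> i) w s x k) (closed_loop f (\<pi> i) w s y k)
    \<le> \<kappa> * \<rho> ^ k * edist n x y"
  using assms shifted_disturbances unfolding closed_loop_shift[of f "\<pi> i" w s] delta_ES_def by blast

lemma control_norm_le:
  assumes "i \<in> {1..N}" "x \<in> Rn n"
  shows "enorm m (\<pi> i x) \<le> \<bar>\<pi>bar\<bar> + L\<pi> * enorm n x"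
proof -
  have "enorm m (\<pi> i x) \<le> enorm m (\<pi> i rzero) + edist m (\<pi> i x) (\<pi> i rzero)"
    by (rule enorm_le_enorm_add_edist)
  also have "\<dots> \<le> \<bar>\<pi>bar\<bar> + L\<pi> * enorm n x"
    using \<pi>_zero[of i] \<pi>_lipschitz[of i x rzero] assms by simp
  finally show ?thesis .
qed

lemma control_growth:
  assumes "i \<in> {1..N}" "x \<in> Rn n"
  shows "enorm n x + enorm m (\<pi> i x) \<le> control_const * (1 + enorm n x) - 1"
proof -
  have "control_const * (1 + enorm n x) - 1
      = L\<pi> + enorm n x + \<bar>\<pi>bar\<bar> + L\<pi> * enorm n x + \<bar>\<pi>bar\<bar> * enorm n x"
    by (simp add: control_gain_def algebra_simps)
  moreover have "0 \<le> \<bar>\<pi>bar\<bar> * enorm n x"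
    by simp
  ultimately show ?thesis
    using L\<pi> control_norm_le[OF assms] by linarith
qed

lemma cost_growth:
  assumes "i \<in> {1..N}" "x \<in> Rn n"
  shows "c t x (\<pi> i x) \<le> cost_const * (1 + enorm n x)\<^sup>2"
proof -
  define q where "q = enorm n x + enorm m (\<pi> i x)"
  have q: "0 \<le> q" "1 + q \<le> control_const * (1 + enorm n x)"
    using control_growth[OF assms] by (auto simp: q_def)
  have "c t x (\<pi> i x) \<le> c t rzero rzero + (Lc1 * q + Lc2) * q"
    using c_lipschitz[of x rzero "\<pi> i x" rzero t] \<pi>_closed assms by (simp add: q_def)
  also have "\<dots> \<le> \<bar>c0\<bar> + (\<bar>Lc1\<bar> * q + \<bar>Lc2\<bar>) * q"
    using c_zero[of t] q by (intro add_mono mult_right_mono) (auto intro: mult_right_mono)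
  also have "\<dots> \<le> (\<bar>Lc1\<bar> + \<bar>Lc2\<bar> + \<bar>c0\<bar>) * (1 + q)\<^sup>2"
    using q by (simp add: power2_eq_square algebra_simps)
  also have "\<dots> \<le> (\<bar>Lc1\<bar> + \<bar>Lc2\<bar> + \<bar>c0\<bar>) * (control_const * (1 + enorm n x))\<^sup>2"
    using q by (intro mult_left_mono power_mono) auto
  finally show ?thesis
    by (simp add: cost_gain_def power_mult_distrib mult.assoc)
qed

text \<open>
  Costs are only locally Lipschitz, with a constant that grows linearly; along a controller this
  gives a bound by the distance of the states alone, on balls.
\<close>

lemma cost_difference:
  assumes i: "i \<in> {1..N}" and x: "x \<in> Rn n" and y: "y \<in> Rn n"
    and r: "enorm n x \<le> r" "enorm n y \<le> r"
  shows "c t x (\<pi> i x) - c t y (\<pi> i y) \<le> cost_const * (1 + r) * edist n x y"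
proof -
  let ?P = control_const and ?L = "\<bar>Lc1\<bar> + \<bar>Lc2\<bar> + \<bar>c0\<bar>"
  have r0: "0 \<le> r"
    using enorm_nonneg r(1) by (rule order_trans)
  have max_le: "max (enorm n x) (enorm n y) + max (enorm m (\<pi> i x)) (enorm m (\<pi> i y)) \<le> ?P * (1 + r)"
  proof -
    have u: "enorm m (\<pi> i z) \<le> \<bar>\<pi>bar\<bar> + L\<pi> * r" if z: "z \<in> Rn n" "enorm n z \<le> r" for z
    proof -
      have "enorm m (\<pi> i z) \<le> \<bar>\<pi>bar\<bar> + L\<pi> * enorm n z"
        by (rule control_norm_le[OF i z(1)])
      also have "\<dots> \<le> \<bar>\<pi>bar\<bar> + L\<pi> * r"
        using L\<pi> z by (intro add_left_mono mult_left_mono) auto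
      finally show ?thesis .
    qed
    have "max (enorm n x) (enorm n y) + max (enorm m (\<pi> i x)) (enorm m (\<pi> i y))
        \<le> r + (\<bar>\<pi>bar\<bar> + L\<pi> * r)"
      using u[of x] u[of y] x y r by (intro add_mono) auto
    also have "\<dots> \<le> ?P * (1 + r)"
      using L\<pi> r0 mult_nonneg_nonneg[of "\<bar>\<pi>bar\<bar>" r] by (simp add: control_gain_def algebra_simps)
    finally show ?thesis .
  qed
  have P1: "1 \<le> ?P * (1 + r)"
    using mult_mono[of 1 ?P 1 "1 + r"] control_const_ge r0 by simp
  have "c t x (\<pi> i x) - c t y (\<pi> i y) \<le>
      (Lc1 * (max (enorm n x) (enorm n y) + max (enorm m (\<pi> i x)) (enorm m (\<pi> i y))) + Lc2)
        * (edist n x y + edist m (\<pi> i x) (\<pi> i y))"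
    using c_lipschitz[of x y "\<pi> i x" "\<pi> i y" t] \<pi>_closed i x y by simp
  also have "\<dots> \<le> (\<bar>Lc1\<bar> * (?P * (1 + r)) + \<bar>Lc2\<bar> * (?P * (1 + r)))
        * (edist n x y + edist m (\<pi> i x) (\<pi> i y))"
  proof (intro mult_right_mono add_mono)
    show "Lc1 * (max (enorm n x) (enorm n y) + max (enorm m (\<pi> i x)) (enorm m (\<pi> i y)))
        \<le> \<bar>Lc1\<bar> * (?P * (1 + r))"
      using max_le by (intro mult_mono) (auto simp: add_nonneg_nonneg le_max_iff_disj)
    show "Lc2 \<le> \<bar>Lc2\<bar> * (?P * (1 + r))"
      using mult_left_mono[OF P1, of "\<bar>Lc2\<bar>"] by simp
  qed simp
  also have "\<dots> \<le> (?L * (?P * (1 + r))) * (?P * edist n x y)"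
  proof (rule mult_mono)
    have "\<bar>Lc1\<bar> * (?P * (1 + r)) + \<bar>Lc2\<bar> * (?P * (1 + r)) = (\<bar>Lc1\<bar> + \<bar>Lc2\<bar>) * (?P * (1 + r))"
      by (simp add: distrib_right)
    also have "\<dots> \<le> ?L * (?P * (1 + r))"
      using P1 by (intro mult_right_mono) auto
    finally show "\<bar>Lc1\<bar> * (?P * (1 + r)) + \<bar>Lc2\<bar> * (?P * (1 + r)) \<le> ?L * (?P * (1 + r))" .
    have "edist n x y + edist m (\<pi> i x) (\<pi> i y) \<le> (L\<pi> + 1) * edist n x y"
      using \<pi>_lipschitz[of i x y] i x y by (simp add: algebra_simps)
    also have "\<dots> \<le> ?P * edist n x y"
      using control_const_ge by (intro mult_right_mono) auto
    finally show "edist n x y + edist m (\<pi> i x) (\<pi> i y) \<le> ?P * edist n x y" .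
  qed (use P1 in auto)
  also have "\<dots> = cost_const * (1 + r) * edist n x y"
    by (simp add: cost_gain_def power2_eq_square mult_ac)
  finally show ?thesis .
qed

lemma state_growth:
  assumes i: "i \<in> {1..N}" and x: "x \<in> Rn n" and v: "v \<in> Rn n" "enorm n v \<le> wmax"
  shows "enorm n (f x (\<pi> i x) v) \<le> Lf * (control_const * (1 + enorm n x) + \<beta> * wmax)"
proof -
  have "enorm n (f x (\<pi> i x) v) = edist n (f x (\<pi> i x) v) (f rzero rzero rzero)"
    by (simp add: f_zero)
  also have "\<dots> \<le> Lf * (enorm n x + enorm m (\<pi> i x) + enorm n v)"
    using f_lipschitz[of x rzero "\<pi> i x" rzero v rzero] \<pi>_closed i x v by simp
  also have "\<dots> \<le> Lf * (control_const * (1 + enorm n x) + \<beta> * wmax)"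
    using Lf control_growth[OF i x] v wmax_le by (intro mult_left_mono) auto
  finally show ?thesis .
qed

section \<open>A single batch\<close>

definition batch_sum :: "nat \<Rightarrow> nat \<Rightarrow> nat \<Rightarrow> nat \<Rightarrow> rvec \<Rightarrow> real" where
  "batch_sum \<tau> T i s x =
     (\<Sum>k<batch_length \<tau> T i s x.
        c (s + k) (closed_loop f (\<pi> i) w s x k) (\<pi> i (closed_loop f (\<pi> i) w s x k)))"

lemma
  assumes "0 < \<tau>" "s \<le> T"
  shows batch_length_pos: "0 < batch_length \<tau> T i s x"
    and batch_length_le: "batch_length \<tau> T i s x \<le> \<tau>" "s + batch_length \<tau> T i s x \<le> Suc T"
    and batch_length_cases:
      "batch_length \<tau> T i s x = min \<tau> (Suc T - s) \<or> violates i s x (batch_length \<tau> T i s x)"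
    and not_violates_before:
      "\<And>k. \<lbrakk>0 < k; k < batch_length \<tau> T i s x\<rbrakk> \<Longrightarrow> \<not> violates i s x k"
proof -
  let ?stop = "\<lambda>k. 0 < k \<and> (k = \<tau> \<or> T < s + k \<or> violates i s x k)"
  define l where "l = batch_length \<tau> T i s x"
  have l: "l = (LEAST k. ?stop k)"
    by (simp add: l_def batch_length_def)
  have horizon: "?stop (min \<tau> (Suc T - s))"
    using assms by auto
  have stop: "?stop l"
    unfolding l by (rule LeastI) (rule horizon)
  have le: "l \<le> min \<tau> (Suc T - s)"
    unfolding l by (rule Least_le) (rule horizon)
  show "0 < batch_length \<tau> T i s x" "batch_length \<tau> T i s x \<le> \<tau>"
    "s + batch_length \<tau> T i s x \<le> Suc T"
    "batch_length \<tau> T i s x = min \<tau> (Suc T - s) \<or> violates i s x (batch_length \<tau> T i s x)"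
    using stop le assms unfolding l_def[symmetric] by auto
  show "\<not> violates i s x k" if "0 < k" "k < batch_length \<tau> T i s x" for k
    using that not_less_Least[of k ?stop] unfolding l_def[symmetric] l by auto
qed

text \<open>
  The test is only evaluated after a stage, so no state at which a cost is incurred violates it;
  the initial state of the batch satisfies the bound because \<open>\<kappa> \<ge> 1\<close>.
\<close>

lemma state_before_violation:
  assumes "0 < \<tau>" "s \<le> T" "k < batch_length \<tau> T i s x"
  shows "enorm n (closed_loop f (\<pi> i) w s x k) \<le> \<kappa> * enorm n x + \<beta> * wmax"
proof (cases "k = 0")
  case True
  then show ?thesis
    using mult_right_mono[OF \<kappa> enorm_nonneg[of n x]] W_nonneg by simp
next
  case False
  then have "enorm n (closed_loop f (\<pi> i) w s x k) \<le> \<kappa> * \<rho> ^ k * enorm n x + \<beta> * wmax"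
    using not_violates_before[OF assms(1,2), of k i x] assms(3) by (simp add: violates_def)
  also have "\<kappa> * \<rho> ^ k * enorm n x \<le> \<kappa> * 1 * enorm n x"
    using \<rho> \<kappa> by (intro mult_right_mono mult_left_mono power_le_one) auto
  finally show ?thesis
    by simp
qed

lemma one_plus_le_state_const:
  assumes "r \<le> \<kappa> * enorm n x + \<beta> * wmax"
  shows "1 + r \<le> state_const * (1 + enorm n x)"
proof -
  have nn: "0 \<le> \<kappa> * enorm n x0"
    using \<kappa> by simp
  then have "0 \<le> (1 + \<beta> * wmax + (\<kappa> * enorm n x0 + \<beta> * wmax)) * enorm n x"
    using W_nonneg by (intro mult_nonneg_nonneg) auto
  moreover have "state_const * (1 + enorm n x) = 1 + \<kappa> + \<beta> * wmax + (\<kappa> * enorm n x0 + \<beta> * wmax)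
      + \<kappa> * enorm n x + (1 + \<beta> * wmax + (\<kappa> * enorm n x0 + \<beta> * wmax)) * enorm n x"
    by (simp add: state_gain_def algebra_simps)
  ultimately show ?thesis
    using assms \<kappa> nn W_nonneg by linarith
qed

lemma batch_sum_nonneg:
  assumes "i \<in> {1..N}" "x \<in> Rn n"
  shows "0 \<le> batch_sum \<tau> T i s x"
  unfolding batch_sum_def
  using assms by (intro sum_nonneg c_nonneg closed_loop_in_Rn \<pi>_closed)

lemma batch_sum_le:
  assumes i: "i \<in> {1..N}" and x: "x \<in> Rn n" and \<tau>: "0 < \<tau>" and s: "s \<le> T"
  shows "batch_sum \<tau> T i s x \<le> real \<tau> * (cost_const * (state_const * (1 + enorm n x))\<^sup>2)"
proof -
  let ?l = "batch_length \<tau> T i s x"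
  have "batch_sum \<tau> T i s x \<le> (\<Sum>k<?l. cost_const * (state_const * (1 + enorm n x))\<^sup>2)"
    unfolding batch_sum_def
  proof (rule sum_mono)
    fix k assume "k \<in> {..<?l}"
    then have k: "enorm n (closed_loop f (\<pi> i) w s x k) \<le> \<kappa> * enorm n x + \<beta> * wmax"
      using state_before_violation[OF \<tau> s] by simp
    have "c (s + k) (closed_loop f (\<pi> i) w s x k) (\<pi> i (closed_loop f (\<pi> i) w s x k))
        \<le> cost_const * (1 + enorm n (closed_loop f (\<pi> i) w s x k))\<^sup>2"
      by (rule cost_growth[OF i closed_loop_in_Rn[OF i x]])
    also have "\<dots> \<le> cost_const * (state_const * (1 + enorm n x))\<^sup>2"
      using one_plus_le_state_const[OF k] cost_const_nonneg
      by (intro mult_left_mono power_mono) auto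
    finally show "c (s + k) (closed_loop f (\<pi> i) w s x k) (\<pi> i (closed_loop f (\<pi> i) w s x k))
        \<le> cost_const * (state_const * (1 + enorm n x))\<^sup>2" .
  qed
  also have "\<dots> = real ?l * (cost_const * (state_const * (1 + enorm n x))\<^sup>2)"
    by simp
  also have "\<dots> \<le> real \<tau> * (cost_const * (state_const * (1 + enorm n x))\<^sup>2)"
    using batch_length_le(1)[OF \<tau> s, of i x] cost_const_nonneg by (intro mult_right_mono) auto
  finally show ?thesis .
qed

text \<open>
  Even if the batch ends with a violation, its last state is one step away from a state that
  passed the test, and one step of the plant grows at most linearly.
\<close>

lemma state_after_batch:
  assumes i: "i \<in> {1..N}" and x: "x \<in> Rn n" and \<tau>: "0 < \<tau>" and s: "s \<le> T"
  shows "enorm n (closed_loop f (\<pi> i) w s x (batch_length \<tau> T i s x))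
    \<le> 2 * Lf * control_const * state_const * (1 + enorm n x)"
proof -
  define l where "l = batch_length \<tau> T i s x - 1"
  define z where "z = closed_loop f (\<pi> i) w s x l"
  have len: "batch_length \<tau> T i s x = Suc l" "l < batch_length \<tau> T i s x"
    using batch_length_pos[OF \<tau> s, of i x] by (auto simp: l_def)
  have z: "z \<in> Rn n"
    unfolding z_def by (rule closed_loop_in_Rn[OF i x])
  have z1: "1 + enorm n z \<le> state_const * (1 + enorm n x)"
    unfolding z_def by (rule one_plus_le_state_const[OF state_before_violation[OF \<tau> s len(2)]])
  have "enorm n (closed_loop f (\<pi> i) w s x (batch_length \<tau> T i s x)) = enorm n (f z (\<pi> i z) (w (s + l)))"
    by (simp add: len z_def)
  also have "\<dots> \<le> Lf * (control_const * (1 + enorm n z) + \<beta> * wmax)"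
    using w by (intro state_growth i z) (auto simp: disturbances_def)
  also have "\<dots> \<le> Lf * (control_const * (state_const * (1 + enorm n x)) + control_const * (state_const * (1 + enorm n x)))"
  proof (intro mult_left_mono add_mono)
    have "\<beta> * wmax \<le> 1 * (state_const * 1)"
      using state_const_ge by simp
    also have "\<dots> \<le> control_const * (state_const * (1 + enorm n x))"
      using control_const_ge state_const_ge by (intro mult_mono) auto
    finally show "\<beta> * wmax \<le> control_const * (state_const * (1 + enorm n x))" .
  qed (use z1 Lf control_const_ge in auto)
  finally show ?thesis
    by (simp add: mult_ac)
qed

section \<open>Batches of a benign controller\<close>

definition benchmark_cost :: "nat \<Rightarrow> nat \<Rightarrow> real" where
  "benchmark_cost i s =
     (\<Sum>t<s. c t (closed_loop f (\<pi> i) w 0 x0 t) (\<pi> i (closed_loop f (\<pi> i) w 0 x0 t)))"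

lemma benignD:
  assumes "i \<in> benign"
  shows "i \<in> {1..N}" "E_ISS n f wmax \<kappa> \<rho> \<beta> (\<pi> i)" "delta_ES n f wmax \<kappa> \<rho> (\<pi> i)"
  using assms by (auto simp: benign_def)

lemma E_ISS_not_violates:
  assumes "E_ISS n f wmax \<kappa> \<rho> \<beta> (\<pi> i)" "x \<in> Rn n"
  shows "\<not> violates i s x k"
  using E_ISS_closed_loop[OF assms, of s k] by (simp add: violates_def)

lemma E_ISS_closed_loop_bounded:
  assumes "E_ISS n f wmax \<kappa> \<rho> \<beta> (\<pi> i)" "x \<in> Rn n"
  shows "enorm n (closed_loop f (\<pi> i) w s x k) \<le> \<kappa> * enorm n x + \<beta> * wmax"
proof -
  have "\<kappa> * \<rho> ^ k * enorm n x \<le> \<kappa> * 1 * enorm n x"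
    using \<rho> \<kappa> by (intro mult_right_mono mult_left_mono power_le_one) auto
  then show ?thesis
    using E_ISS_closed_loop[OF assms, of s k] by simp
qed

lemma benchmark_cost_mono:
  assumes "i \<in> {1..N}" "s \<le> s'"
  shows "benchmark_cost i s \<le> benchmark_cost i s'"
  unfolding benchmark_cost_def using assms x0
  by (intro sum_mono2 c_nonneg closed_loop_in_Rn \<pi>_closed) auto

lemma benchmark_cost_increment_le:
  assumes i: "i \<in> benign"
  shows "benchmark_cost i (s + l) - benchmark_cost i s \<le> real l * (cost_const * state_const\<^sup>2)"
proof -
  let ?y = "closed_loop f (\<pi> i) w 0 x0"
  have iN: "i \<in> {1..N}"
    using benignD[OF i] by simp
  have "benchmark_cost i (s + l) - benchmark_cost i s = (\<Sum>t = s..<s + l. c t (?y t) (\<pi> i (?y t)))"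
    unfolding benchmark_cost_def by (simp add: lessThan_atLeast0 sum_diff_nat_ivl)
  also have "\<dots> \<le> (\<Sum>t = s..<s + l. cost_const * state_const\<^sup>2)"
  proof (rule sum_mono)
    fix t
    have y: "enorm n (?y t) \<le> \<kappa> * enorm n x0 + \<beta> * wmax"
      using benignD[OF i] x0 by (intro E_ISS_closed_loop_bounded) auto
    have "c t (?y t) (\<pi> i (?y t)) \<le> cost_const * (1 + enorm n (?y t))\<^sup>2"
      by (rule cost_growth[OF iN closed_loop_in_Rn[OF iN x0]])
    also have "\<dots> \<le> cost_const * state_const\<^sup>2"
      using y cost_const_nonneg \<kappa> W_nonneg
      by (intro mult_left_mono power_mono) (auto simp: state_gain_def)
    finally show "c t (?y t) (\<pi> i (?y t)) \<le> cost_const * state_const\<^sup>2" .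
  qed
  finally show ?thesis
    by simp
qed

text \<open>
  The trajectory of \<open>i\<close> from the current plant state \<open>x\<close> merges geometrically with its trajectory
  from \<open>x\<^sub>0\<close>, by \<open>\<delta>\<close>-ES, and both stay bounded, by E-ISS; so the two costs differ by a geometric
  series. The benchmark is read off up to the horizon of the batch of \<open>i\<close>, which never
  breaks, and not up to the end of the batch that is really played.
\<close>

lemma batch_sum_benign_le:
  assumes i: "i \<in> benign" and x: "x \<in> Rn n" and \<tau>: "0 < \<tau>" and s: "s \<le> T"
  shows "batch_sum \<tau> T i s x
    \<le> benchmark_cost i (s + min \<tau> (Suc T - s)) - benchmark_cost i s
      + cost_const * \<kappa> / (1 - \<rho>) * (state_const * (1 + enorm n x))\<^sup>2"
proof -
  let ?l = "min \<tau> (Suc T - s)" and ?B = "state_const * (1 + enorm n x)"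
  let ?y = "closed_loop f (\<pi> i) w 0 x0"
  let ?x = "closed_loop f (\<pi> i) w s x"
  note bi = benignD[OF i]
  have len: "batch_length \<tau> T i s x = ?l"
    using batch_length_cases[OF \<tau> s] E_ISS_not_violates[OF bi(2) x] by blast
  define r where "r = \<kappa> * enorm n x + \<kappa> * enorm n x0 + \<beta> * wmax"
  have nn: "0 \<le> \<kappa> * enorm n x0" "0 \<le> \<kappa> * enorm n x"
    using \<kappa> by auto
  have r: "0 \<le> r"
    using nn W_nonneg by (simp add: r_def)
  have rB: "1 + r + \<beta> * wmax \<le> ?B"
  proof -
    have "0 \<le> (1 + \<beta> * wmax + (\<kappa> * enorm n x0 + \<beta> * wmax)) * enorm n x"
      using nn W_nonneg by (intro mult_nonneg_nonneg) auto
    then show ?thesis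
      using \<kappa> by (simp add: r_def state_gain_def algebra_simps)
  qed
  have ys: "?y s \<in> Rn n"
    by (rule closed_loop_in_Rn[OF bi(1) x0])
  have d0: "edist n x (?y s) \<le> ?B"
  proof -
    have "edist n x (?y s) \<le> enorm n x + enorm n (?y s)"
      by (rule edist_le_enorm_add)
    also have "\<dots> \<le> \<kappa> * enorm n x + (\<kappa> * enorm n x0 + \<beta> * wmax)"
      using mult_right_mono[OF \<kappa> enorm_nonneg[of n x]] E_ISS_closed_loop_bounded[OF bi(2) x0, of 0 s]
      by simp
    also have "\<dots> \<le> ?B"
      using rB W_nonneg by (simp add: r_def)
    finally show ?thesis .
  qed
  \<comment> \<open>On the ball of radius \<open>r\<close> the cost is Lipschitz, and the distance contracts geometrically.\<close>
  have step: "c (s + k) (?x k) (\<pi> i (?x k)) - c (s + k) (?y (s + k)) (\<pi> i (?y (s + k)))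
      \<le> cost_const * \<kappa> * ?B\<^sup>2 * \<rho> ^ k" for k
  proof -
    have "c (s + k) (?x k) (\<pi> i (?x k)) - c (s + k) (?y (s + k)) (\<pi> i (?y (s + k)))
        \<le> cost_const * (1 + r) * edist n (?x k) (?y (s + k))"
      using E_ISS_closed_loop_bounded[OF bi(2) x, of s k] E_ISS_closed_loop_bounded[OF bi(2) x0, of 0 "s + k"] nn
      by (intro cost_difference closed_loop_in_Rn bi x x0) (auto simp: r_def)
    also have "edist n (?x k) (?y (s + k)) = edist n (?x k) (closed_loop f (\<pi> i) w s (?y s) k)"
      using closed_loop_add[of f "\<pi> i" w 0 x0 s k] by simp
    also have "cost_const * (1 + r) * \<dots> \<le> cost_const * ?B * (\<kappa> * \<rho> ^ k * edist n x (?y s))"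
      using delta_ES_closed_loop[OF bi(3) x ys, of s k] rB W_nonneg cost_const_nonneg r
      by (intro mult_mono) auto
    also have "\<dots> \<le> cost_const * ?B * (\<kappa> * \<rho> ^ k * ?B)"
      using d0 cost_const_nonneg state_const_ge \<kappa> \<rho> by (intro mult_left_mono) auto
    finally show ?thesis
      by (simp add: power2_eq_square mult_ac)
  qed
  have "batch_sum \<tau> T i s x = (\<Sum>k<?l. c (s + k) (?x k) (\<pi> i (?x k)))"
    by (simp add: batch_sum_def len)
  also have "\<dots> \<le> (\<Sum>k<?l. c (s + k) (?y (s + k)) (\<pi> i (?y (s + k))) + cost_const * \<kappa> * ?B\<^sup>2 * \<rho> ^ k)"
    using step by (intro sum_mono) (simp add: algebra_simps)
  also have "\<dots> = (\<Sum>k<?l. c (s + k) (?y (s + k)) (\<pi> i (?y (s + k)))) + cost_const * \<kappa> * ?B\<^sup>2 * (\<Sum>k<?l. \<rho> ^ k)"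
    by (simp add: sum.distrib sum_distrib_left)
  also have "(\<Sum>k<?l. c (s + k) (?y (s + k)) (\<pi> i (?y (s + k)))) = benchmark_cost i (s + ?l) - benchmark_cost i s"
  proof -
    have "benchmark_cost i (s + ?l) - benchmark_cost i s
        = (\<Sum>t = s..<s + ?l. c t (?y t) (\<pi> i (?y t)))"
      unfolding benchmark_cost_def by (simp add: lessThan_atLeast0 sum_diff_nat_ivl)
    also have "\<dots> = (\<Sum>k<?l. c (s + k) (?y (s + k)) (\<pi> i (?y (s + k))))"
      using sum.shift_bounds_nat_ivl[of "\<lambda>t. c t (?y t) (\<pi> i (?y t))" 0 s ?l]
      by (simp add: lessThan_atLeast0 add.commute)
    finally show ?thesis ..
  qed
  also have "cost_const * \<kappa> * ?B\<^sup>2 * (\<Sum>k<?l. \<rho> ^ k) \<le> cost_const * \<kappa> * ?B\<^sup>2 * (1 / (1 - \<rho>))"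
  proof (rule mult_left_mono)
    show "(\<Sum>k<?l. \<rho> ^ k) \<le> 1 / (1 - \<rho>)"
      using \<rho> by (subst sum_gp_strict) (auto simp: divide_right_mono)
  qed (use cost_const_nonneg \<kappa> in auto)
  finally show ?thesis
    by (simp add: field_simps)
qed

end

section \<open>Bursts of the plant state\<close>

lemma power4_sum_le:
  fixes a b :: real
  shows "(a + b) ^ 4 \<le> 8 * (a ^ 4 + b ^ 4)"
proof -
  have sq: "(u + v)\<^sup>2 \<le> 2 * (u\<^sup>2 + v\<^sup>2)" for u v :: real
    using zero_le_power2[of "u - v"] by (simp add: power2_eq_square algebra_simps)
  have "(a + b) ^ 4 = ((a + b)\<^sup>2)\<^sup>2"
    by simp
  also have "\<dots> \<le> (2 * (a\<^sup>2 + b\<^sup>2))\<^sup>2"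
    by (intro power_mono sq) auto
  also have "\<dots> = 4 * (a\<^sup>2 + b\<^sup>2)\<^sup>2"
    by (subst power_mult_distrib) simp
  also have "\<dots> \<le> 4 * (2 * ((a\<^sup>2)\<^sup>2 + (b\<^sup>2)\<^sup>2))"
    by (intro mult_left_mono sq) auto
  finally show ?thesis
    by simp
qed

text \<open>
  Where the state is small, its fourth power is charged to the batch at a constant rate. Only the
  excess over this level has to be amortized. It decays to zero without an additive term,
  so that its sum does not depend on the number of batches.
\<close>

definition quiet_level :: "real \<Rightarrow> real" where
  "quiet_level W = 16 * W ^ 4"

definition excess :: "real \<Rightarrow> real \<Rightarrow> real" where
  "excess W r = max (r ^ 4 - quiet_level W) 0"

lemma quiet_level_nonneg: "0 \<le> quiet_level W"
  by (simp add: quiet_level_def)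

lemma excess_nonneg: "0 \<le> excess W r"
  by (simp add: excess_def)

lemma power4_le_excess: "r ^ 4 \<le> excess W r + quiet_level W"
  by (simp add: excess_def)

lemma excess_le: "0 \<le> r \<Longrightarrow> excess W r \<le> r ^ 4"
  using quiet_level_nonneg[of W] by (simp add: excess_def)

text \<open>
  By \<open>(a + b)\<^sup>4 \<le> 8 (a\<^sup>4 + b\<^sup>4)\<close>, dividing by \<open>2 \<surd>2\<close> shrinks the fourth power by \<open>8 / 64\<close>;
  the level is chosen so large that it absorbs the term \<open>8 W\<^sup>4\<close>.
\<close>

lemma excess_contraction:
  assumes "0 \<le> r'" "r' \<le> r / (2 * sqrt 2) + W"
  shows "excess W r' \<le> excess W r / 4"
proof -
  have "r' ^ 4 \<le> (r / (2 * sqrt 2) + W) ^ 4"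
    using assms by (intro power_mono)
  also have "\<dots> \<le> 8 * ((r / (2 * sqrt 2)) ^ 4 + W ^ 4)"
    by (rule power4_sum_le)
  also have "(r / (2 * sqrt 2)) ^ 4 = r ^ 4 / 64"
  proof -
    have "(sqrt 2) ^ 4 = ((sqrt 2)\<^sup>2)\<^sup>2"
      by (simp only: flip: power_mult) simp
    then show ?thesis
      by (simp add: power_divide power_mult_distrib)
  qed
  finally have bound: "r' ^ 4 \<le> r ^ 4 / 8 + 8 * W ^ 4"
    by simp
  have linear: "v' - 16 * u \<le> (v - 16 * u) / 4"
    if "v' \<le> v / 8 + 8 * u" "0 \<le> v" "0 \<le> u" for u v v' :: real
    using that by (simp add: field_simps)
  have "r' ^ 4 - quiet_level W \<le> (r ^ 4 - quiet_level W) / 4"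
    unfolding quiet_level_def by (rule linear[OF bound]) simp_all
  also have "\<dots> \<le> excess W r / 4"
    unfolding excess_def by (intro divide_right_mono) auto
  finally have "r' ^ 4 - quiet_level W \<le> excess W r / 4" .
  then show ?thesis
    using excess_nonneg[of W r] unfolding excess_def[of W r'] by (intro max.boundedI) auto
qed

definition jump_gain :: "real \<Rightarrow> real \<Rightarrow> real" where
  "jump_gain K W = 8 * K ^ 4 * (1 + quiet_level W)"

lemma jump_gain_nonneg: "0 \<le> jump_gain K W"
  using quiet_level_nonneg[of W] by (simp add: jump_gain_def)

lemma excess_jump:
  assumes "0 \<le> r'" "r' \<le> K * (1 + r)"
  shows "excess W r' \<le> jump_gain K W * (1 + excess W r)"
proof -
  have "excess W r' \<le> r' ^ 4"
    using assms by (intro excess_le)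
  also have "\<dots> \<le> (K * (1 + r)) ^ 4"
    using assms by (intro power_mono)
  also have "\<dots> = K ^ 4 * (1 + r) ^ 4"
    by (rule power_mult_distrib)
  also have "\<dots> \<le> K ^ 4 * (8 * ((1 + quiet_level W) * (1 + excess W r)))"
  proof (rule mult_left_mono)
    have "(1 + r) ^ 4 \<le> 8 * (1 + r ^ 4)"
      using power4_sum_le[of 1 r] by simp
    also have "1 + r ^ 4 \<le> (1 + quiet_level W) * (1 + excess W r)"
      using power4_le_excess[of r W] mult_nonneg_nonneg[OF quiet_level_nonneg[of W] excess_nonneg[of W r]]
      by (simp add: algebra_simps)
    finally show "(1 + r) ^ 4 \<le> 8 * ((1 + quiet_level W) * (1 + excess W r))"
      by simp
  qed simp
  finally show ?thesis
    by (simp only: jump_gain_def mult_ac)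
qed

definition burst_rate :: "real \<Rightarrow> real \<Rightarrow> real" where
  "burst_rate K W = 2 * jump_gain K W + 2"

lemma burst_rate_ge: "2 \<le> burst_rate K W"
  using jump_gain_nonneg[of K W] by (simp add: burst_rate_def)

text \<open>
  With \<open>b\<close> jumps left, a state of norm \<open>r\<close> can cause at most this total excess: every jump
  multiplies what is left to pay by \<open>burst_rate\<close>, and the summand 1 pays for jumps from a quiet
  state.
\<close>

definition burst_potential :: "real \<Rightarrow> real \<Rightarrow> nat \<Rightarrow> real \<Rightarrow> real" where
  "burst_potential K W b r = burst_rate K W ^ b * (2 * excess W r + 1)"

lemma burst_potential_ge: "2 * excess W r \<le> burst_potential K W b r"
proof -
  have "1 * (2 * excess W r + 1) \<le> burst_potential K W b r"
    unfolding burst_potential_def using burst_rate_ge[of K W] excess_nonneg[of W r]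
    by (intro mult_right_mono one_le_power) auto
  then show ?thesis
    by simp
qed

lemma burst_potential_contraction:
  assumes "0 \<le> r'" "r' \<le> r / (2 * sqrt 2) + W"
  shows "burst_potential K W b r' + excess W r \<le> burst_potential K W b r"
proof -
  have pow: "1 \<le> burst_rate K W ^ b"
    using burst_rate_ge[of K W] by (intro one_le_power) auto
  have "burst_potential K W b r' + excess W r
      \<le> burst_rate K W ^ b * (2 * (excess W r / 4) + 1) + burst_rate K W ^ b * excess W r"
    unfolding burst_potential_def using excess_contraction[OF assms] pow
      mult_right_mono[OF pow excess_nonneg[of W r]]
    by (intro add_mono mult_left_mono) auto
  also have "\<dots> = burst_rate K W ^ b * (3 / 2 * excess W r + 1)"
    by (simp add: algebra_simps)
  also have "\<dots> \<le> burst_potential K W b r"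
    unfolding burst_potential_def using pow excess_nonneg[of W r]
    by (intro mult_left_mono) auto
  finally show ?thesis .
qed

lemma burst_potential_jump:
  assumes "0 \<le> r'" "r' \<le> K * (1 + r)"
  shows "burst_potential K W b r' + excess W r \<le> burst_potential K W (Suc b) r"
proof -
  let ?e = "excess W r" and ?Q = "jump_gain K W"
  have pow: "1 \<le> burst_rate K W ^ b"
    using burst_rate_ge[of K W] by (intro one_le_power) auto
  have "burst_potential K W b r' + ?e
      \<le> burst_rate K W ^ b * (2 * (?Q * (1 + ?e)) + 1) + burst_rate K W ^ b * ?e"
    unfolding burst_potential_def using excess_jump[OF assms, of W] pow
      mult_right_mono[OF pow excess_nonneg[of W r]]
    by (intro add_mono mult_left_mono) auto
  also have "\<dots> = burst_rate K W ^ b * (2 * ?Q * (1 + ?e) + 1 + ?e)"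
    by (simp add: algebra_simps)
  also have "\<dots> \<le> burst_rate K W ^ b * (burst_rate K W * (2 * ?e + 1))"
    using pow excess_nonneg[of W r] mult_nonneg_nonneg[OF jump_gain_nonneg[of K W] excess_nonneg[of W r]]
    by (intro mult_left_mono) (auto simp: burst_rate_def algebra_simps)
  finally show ?thesis
    by (simp add: burst_potential_def mult_ac)
qed

section \<open>The run as a supermartingale\<close>

text \<open>
  Bounds the EXP3 loss terms of one batch in units of \<open>(1 + \<parallel>x\<parallel>)\<^sup>4\<close>: the squared losses of all
  arms (first summand; \<open>E\<close> bounds \<open>\<tau> \<eta> N\<close>) and the price for restarting the benign controller in
  a foreign state (second summand).
\<close>

definition loss_gain :: "real \<Rightarrow> real \<Rightarrow> real \<Rightarrow> real \<Rightarrow> real \<Rightarrow> real" where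
  "loss_gain C B \<kappa> \<rho> E = E / 2 * (C * B\<^sup>2)\<^sup>2 + C * \<kappa> / (1 - \<rho>) * B\<^sup>2"

locale exp3_iss_run = switching_control +
  fixes istar :: nat and \<eta> :: real and \<tau> T :: nat and E :: real
  assumes istar: "istar \<in> benign"
    and \<eta>: "0 < \<eta>" and \<tau>: "0 < \<tau>" and \<tau>_contracts: "\<kappa> * \<rho> ^ \<tau> \<le> 1 / (2 * sqrt 2)"
    and step_size: "real \<tau> * \<eta> * real N \<le> E"
begin

abbreviation play :: "exp3_state \<Rightarrow> nat \<Rightarrow> exp3_state" where
  "play \<equiv> play_batch (\<lambda>_. \<eta>) \<tau> T"

abbreviation run :: "nat \<Rightarrow> exp3_state pmf" where
  "run \<equiv> exp3_iss (\<lambda>_. \<eta>) \<tau> T"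

text \<open>
  The invariant of the run. The comparator stays active because an E-ISS controller never fails
  the test.
\<close>

definition valid :: "exp3_state \<Rightarrow> bool" where
  "valid S \<longleftrightarrow> plant_of S \<in> Rn n \<and> stage_of S \<le> Suc T \<and> active_of S \<subseteq> {1..N} \<and> istar \<in> active_of S
     \<and> sampler_of S = exp_weights \<eta> (estimate_of S) (active_of S)"

text \<open>Only these controllers can still break a batch, each of them at most once.\<close>

definition unstable :: "exp3_state \<Rightarrow> nat" where
  "unstable S = card {k \<in> active_of S. \<not> E_ISS n f wmax \<kappa> \<rho> \<beta> (\<pi> k)}"

text \<open>
  A broken batch removes an unstable controller, and any other batch but the last uses up \<open>\<tau>\<close>
  stages.
\<close>

definition batches_left :: "exp3_state \<Rightarrow> real" where
  "batches_left S = real (unstable S) +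
     (if stage_of S \<le> T then real (Suc T - stage_of S) / real \<tau> + 1 else 0)"

abbreviation excess_of :: "exp3_state \<Rightarrow> real" where
  "excess_of S \<equiv> excess (\<beta> * wmax) (enorm n (plant_of S))"

text \<open>
  The potential vanishes after the horizon: the last batch may be cut short and then
  need not contract, but no later batch starts in its final state.
\<close>

definition burst_left :: "exp3_state \<Rightarrow> real" where
  "burst_left S = (if stage_of S \<le> T
     then burst_potential (2 * Lf * control_const * state_const) (\<beta> * wmax)
       (unstable S) (enorm n (plant_of S))
     else 0)"

abbreviation loss_const :: real where
  "loss_const \<equiv> loss_gain cost_const state_const \<kappa> \<rho> E"

abbreviation arm_cost :: "exp3_state \<Rightarrow> nat \<Rightarrow> real" where
  "arm_cost S k \<equiv> batch_sum \<tau> T k (stage_of S) (plant_of S)"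

text \<open>
  The loss terms of a batch that are left after taking the expectation over the drawn arm: the
  second-order EXP3 terms of all arms, and the loss of the comparator.
\<close>

definition batch_charge :: "exp3_state \<Rightarrow> real" where
  "batch_charge S =
     (\<Sum>k\<in>active_of S. \<eta> / (2 * real \<tau>) * (arm_cost S k)\<^sup>2) + arm_cost S istar"

text \<open>
  The budget pays for the charges of all batches to come. Its first two summands pay for the true
  cost of \<open>i\<^sup>*\<close>: the benchmark advances with the stages that are played, and if a batch breaks,
  the rest of the horizon of that batch, at most \<open>\<tau>\<close> stages, is paid by the removed controller. The
  last summand pays for all terms that are proportional to fourth powers of the states.
\<close>

definition budget :: "exp3_state \<Rightarrow> real" where
  "budget S = - benchmark_cost istar (stage_of S)
     + cost_const * state_const\<^sup>2 * real \<tau> * real (unstable S)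
     + 8 * loss_const * (burst_left S + (1 + quiet_level (\<beta> * wmax)) * batches_left S)"

definition exp3_potential :: "exp3_state \<Rightarrow> real" where
  "exp3_potential S = cost_of S
     + real \<tau> * (log_weight \<eta> (estimate_of S) (active_of S) + estimate_of S istar)"

lemma istar_facts:
  "istar \<in> {1..N}" "E_ISS n f wmax \<kappa> \<rho> \<beta> (\<pi> istar)"
  using benignD[OF istar] by auto

lemma play_simps:
  fixes S i
  defines "l \<equiv> batch_length \<tau> T i (stage_of S) (plant_of S)"
  shows "stage_of (play S i) = stage_of S + l"
    "plant_of (play S i) = closed_loop f (\<pi> i) w (stage_of S) (plant_of S) l"
    "active_of (play S i)
      = (if violates i (stage_of S) (plant_of S) l then active_of S - {i} else active_of S)"
    "estimate_of (play S i) = (\<lambda>k. estimate_of S k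
      + (if k = i then arm_cost S i / real \<tau> / pmf (sampler_of S) k else 0))"
    "sampler_of (play S i) = exp_weights \<eta> (estimate_of (play S i)) (active_of (play S i))"
    "cost_of (play S i) = cost_of S + arm_cost S i"
  unfolding l_def batch_sum_def by (simp_all add: play_batch_def Let_def)

lemma validD:
  assumes "valid S"
  shows "plant_of S \<in> Rn n" "finite (active_of S)" "active_of S \<subseteq> {1..N}" "istar \<in> active_of S"
    "active_of S \<noteq> {}" "sampler_of S = exp_weights \<eta> (estimate_of S) (active_of S)"
    "card (active_of S) \<le> N"
  using assms card_mono[of "{1..N}" "active_of S"] by (auto simp: valid_def intro: finite_subset)

lemma valid_play:
  assumes "valid S" "stage_of S \<le> T" "i \<in> active_of S"
  shows "valid (play S i)"
proof -
  note v = validD[OF assms(1)]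
  have i: "i \<in> {1..N}"
    using v assms(3) by auto
  show ?thesis
    unfolding valid_def
  proof (intro conjI)
    show "plant_of (play S i) \<in> Rn n"
      unfolding play_simps by (rule closed_loop_in_Rn[OF i v(1)])
    show "stage_of (play S i) \<le> Suc T"
      unfolding play_simps by (rule batch_length_le(2)[OF \<tau> assms(2)])
    show "active_of (play S i) \<subseteq> {1..N}" "istar \<in> active_of (play S i)"
      using v(3,4) E_ISS_not_violates[OF istar_facts(2) v(1)] by (auto simp: play_simps)
  qed (rule play_simps(5))
qed

text \<open>
  A batch either removes a controller that is not E-ISS, or it runs to its horizon; in the
  latter case, if stages are left, it had full length and contracted the state.
\<close>

lemma play_cases:
  assumes S: "valid S" "stage_of S \<le> T" and i: "i \<in> active_of S"
  obtains (removed) "Suc (unstable (play S i)) = unstable S"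
      "stage_of S < stage_of (play S i)"
  | (kept) "unstable (play S i) = unstable S"
      "stage_of (play S i) = stage_of S + min \<tau> (Suc T - stage_of S)"
      "stage_of (play S i) \<le> T \<Longrightarrow> enorm n (plant_of (play S i))
        \<le> enorm n (plant_of S) / (2 * sqrt 2) + \<beta> * wmax"
proof (cases "violates i (stage_of S) (plant_of S)
    (batch_length \<tau> T i (stage_of S) (plant_of S))")
  case True
  note v = validD[OF S(1)]
  let ?U = "{k \<in> active_of S. \<not> E_ISS n f wmax \<kappa> \<rho> \<beta> (\<pi> k)}"
  have iU: "i \<in> ?U"
    using i True E_ISS_not_violates[of i "plant_of S" "stage_of S"] v(1) by auto
  have U': "{k \<in> active_of (play S i). \<not> E_ISS n f wmax \<kappa> \<rho> \<beta> (\<pi> k)} = ?U - {i}"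
    using True by (auto simp: play_simps)
  have "finite ?U"
    using v(2) by simp
  from card_Suc_Diff1[OF this iU] have "Suc (unstable (play S i)) = unstable S"
    unfolding unstable_def U' .
  moreover have "stage_of S < stage_of (play S i)"
    using batch_length_pos[OF \<tau> S(2)] by (simp add: play_simps)
  ultimately show ?thesis
    by (rule removed)
next
  case False
  let ?l = "batch_length \<tau> T i (stage_of S) (plant_of S)"
  have l: "?l = min \<tau> (Suc T - stage_of S)"
    using batch_length_cases[OF \<tau> S(2), of i "plant_of S"] False by simp
  show ?thesis
  proof (rule kept)
    show "unstable (play S i) = unstable S"
      using False by (simp add: unstable_def play_simps)
    show "stage_of (play S i) = stage_of S + min \<tau> (Suc T - stage_of S)"
      by (simp add: play_simps l)
    assume "stage_of (play S i) \<le> T"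
    then have "?l = \<tau>"
      using l S(2) by (auto simp: play_simps min_def split: if_splits)
    then have "enorm n (plant_of (play S i))
        \<le> \<kappa> * \<rho> ^ \<tau> * enorm n (plant_of S) + \<beta> * wmax"
      using False by (simp add: violates_def play_simps)
    also have "\<kappa> * \<rho> ^ \<tau> * enorm n (plant_of S) \<le> 1 / (2 * sqrt 2) * enorm n (plant_of S)"
      by (intro mult_right_mono \<tau>_contracts) simp
    finally show "enorm n (plant_of (play S i)) \<le> enorm n (plant_of S) / (2 * sqrt 2) + \<beta> * wmax"
      by simp
  qed
qed

lemma batches_left_play:
  assumes S: "valid S" "stage_of S \<le> T" and i: "i \<in> active_of S"
  shows "batches_left (play S i) + 1 \<le> batches_left S"
  using assms
proof (cases rule: play_cases)
  case removed
  have "real (Suc T - stage_of (play S i)) / real \<tau> \<le> real (Suc T - stage_of S) / real \<tau>"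
    using removed by (intro divide_right_mono) auto
  moreover have "0 \<le> real (Suc T - stage_of S) / real \<tau>"
    by simp
  moreover have "real (unstable S) = real (unstable (play S i)) + 1"
    by (simp flip: removed(1))
  ultimately show ?thesis
    using S(2) unfolding batches_left_def by auto
next
  case kept
  show ?thesis
  proof (cases "stage_of (play S i) \<le> T")
    case True
    then have "stage_of (play S i) = stage_of S + \<tau>"
      using kept(2) S(2) by (auto simp: min_def split: if_splits)
    then have "real (Suc T - stage_of S) = real (Suc T - stage_of (play S i)) + real \<tau>"
      using True by (simp add: of_nat_diff)
    then have "real (Suc T - stage_of S) / real \<tau> = real (Suc T - stage_of (play S i)) / real \<tau> + 1"
      using \<tau> by (simp only: add_divide_distrib) simp
    then show ?thesis
      unfolding batches_left_def kept(1) using True S(2) by simp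
  next
    case False
    then show ?thesis
      using S(2) kept(1) by (simp add: batches_left_def)
  qed
qed

lemma burst_left_play:
  assumes S: "valid S" "stage_of S \<le> T" and i: "i \<in> active_of S"
  shows "burst_left (play S i) + excess_of S \<le> burst_left S"
proof (cases "stage_of (play S i) \<le> T")
  case False
  let ?K = "2 * Lf * control_const * state_const"
  have "burst_left (play S i) + excess_of S = excess_of S"
    using False by (simp add: burst_left_def)
  also have "\<dots> \<le> burst_left S"
    using S burst_potential_ge[of "\<beta> * wmax" "enorm n (plant_of S)" ?K "unstable S"]
      excess_nonneg[of "\<beta> * wmax" "enorm n (plant_of S)"]
    by (simp add: burst_left_def)
  finally show ?thesis .
next
  case True
  have iN: "i \<in> {1..N}"
    using validD[OF S(1)] i by auto
  from assms show ?thesis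
  proof (cases rule: play_cases)
    case removed
    have "enorm n (plant_of (play S i))
        \<le> 2 * Lf * control_const * state_const * (1 + enorm n (plant_of S))"
      using state_after_batch[OF iN validD(1)[OF S(1)] \<tau> S(2)] by (simp add: play_simps)
    from burst_potential_jump[OF enorm_nonneg this, of "\<beta> * wmax" "unstable (play S i)"]
    show ?thesis
      using True S(2) by (simp add: burst_left_def removed(1))
  next
    case kept
    from burst_potential_contraction[OF enorm_nonneg kept(3)[OF True]]
    show ?thesis
      using True S(2) by (simp add: burst_left_def kept(1))
  qed
qed

lemma E_nonneg: "0 \<le> E"
proof -
  have "0 \<le> real \<tau> * \<eta> * real N"
    using \<eta> by simp
  then show ?thesis
    using step_size by linarith
qed

lemma loss_const_nonneg: "0 \<le> loss_const"
  using cost_const_nonneg \<kappa> \<rho> E_nonneg by (simp add: loss_gain_def)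

text \<open>
  Each loss is at most \<open>\<tau>\<close> times a multiple of \<open>(1 + \<parallel>x\<parallel>)\<^sup>2\<close>, so the \<open>N\<close> squared losses carry the
  factor \<open>\<tau> \<eta> N\<close>, which is bounded by \<open>E\<close>.
\<close>

lemma batch_charge_le:
  assumes S: "valid S" "stage_of S \<le> T"
  shows "batch_charge S \<le>
    benchmark_cost istar (stage_of S + min \<tau> (Suc T - stage_of S)) - benchmark_cost istar (stage_of S)
    + 8 * loss_const * (excess_of S + (1 + quiet_level (\<beta> * wmax)))"
proof -
  note v = validD[OF S(1)]
  let ?r = "1 + enorm n (plant_of S)" and ?C = cost_const and ?B = state_const
  have r: "1 \<le> ?r"
    by simp
  have square: "\<eta> / (2 * real \<tau>) * (arm_cost S k)\<^sup>2 \<le> real \<tau> * \<eta> / 2 * ((?C * ?B\<^sup>2)\<^sup>2 * ?r ^ 4)"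
    if "k \<in> active_of S" for k
  proof -
    have k: "k \<in> {1..N}"
      using that v by auto
    have "\<eta> / (2 * real \<tau>) * (arm_cost S k)\<^sup>2
        \<le> \<eta> / (2 * real \<tau>) * (real \<tau> * (?C * (?B * ?r)\<^sup>2))\<^sup>2"
      using batch_sum_le[OF k v(1) \<tau> S(2)] batch_sum_nonneg[OF k v(1)] \<eta>
      by (intro mult_left_mono power_mono) auto
    also have "\<dots> = real \<tau> * \<eta> / 2 * ((?C * ?B\<^sup>2)\<^sup>2 * (?r\<^sup>2)\<^sup>2)"
      using \<tau> by (simp only: power_mult_distrib) (simp add: power2_eq_square field_simps)
    finally show ?thesis
      by simp
  qed
  have "(\<Sum>k\<in>active_of S. \<eta> / (2 * real \<tau>) * (arm_cost S k)\<^sup>2)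
      \<le> real (card (active_of S)) * (real \<tau> * \<eta> / 2 * ((?C * ?B\<^sup>2)\<^sup>2 * ?r ^ 4))"
    using square by (rule sum_bounded_above)
  also have "\<dots> \<le> real N * (real \<tau> * \<eta> / 2 * ((?C * ?B\<^sup>2)\<^sup>2 * ?r ^ 4))"
    using v \<eta> by (intro mult_right_mono) auto
  also have "\<dots> = (real \<tau> * \<eta> * real N) * ((?C * ?B\<^sup>2)\<^sup>2 * ?r ^ 4 / 2)"
    by simp
  also have "\<dots> \<le> E * ((?C * ?B\<^sup>2)\<^sup>2 * ?r ^ 4 / 2)"
    by (intro mult_right_mono step_size) simp
  finally have squares: "(\<Sum>k\<in>active_of S. \<eta> / (2 * real \<tau>) * (arm_cost S k)\<^sup>2)
      \<le> E / 2 * (?C * ?B\<^sup>2)\<^sup>2 * ?r ^ 4"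
    by simp
  have "?C * \<kappa> / (1 - \<rho>) * (?B * ?r)\<^sup>2 \<le> ?C * \<kappa> / (1 - \<rho>) * ?B\<^sup>2 * ?r ^ 4"
  proof -
    have "?r\<^sup>2 \<le> ?r ^ 4"
      using r by (intro power_increasing) auto
    then have "?C * \<kappa> / (1 - \<rho>) * ?B\<^sup>2 * ?r\<^sup>2 \<le> ?C * \<kappa> / (1 - \<rho>) * ?B\<^sup>2 * ?r ^ 4"
      using cost_const_nonneg \<kappa> \<rho> by (intro mult_left_mono) auto
    then show ?thesis
      by (simp only: power_mult_distrib mult.assoc)
  qed
  then have benign: "arm_cost S istar \<le>
      benchmark_cost istar (stage_of S + min \<tau> (Suc T - stage_of S)) - benchmark_cost istar (stage_of S)
      + ?C * \<kappa> / (1 - \<rho>) * ?B\<^sup>2 * ?r ^ 4"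
    using batch_sum_benign_le[OF istar v(1) \<tau> S(2)] by linarith
  have "loss_const * ?r ^ 4 \<le> loss_const * (8 * (excess_of S + (1 + quiet_level (\<beta> * wmax))))"
  proof (intro mult_left_mono loss_const_nonneg)
    show "?r ^ 4 \<le> 8 * (excess_of S + (1 + quiet_level (\<beta> * wmax)))"
      using power4_sum_le[of 1 "enorm n (plant_of S)"]
        power4_le_excess[of "enorm n (plant_of S)" "\<beta> * wmax"] by simp
  qed
  also have "\<dots> = 8 * loss_const * (excess_of S + (1 + quiet_level (\<beta> * wmax)))"
    by (simp only: mult_ac)
  also have "loss_const * ?r ^ 4
      = E / 2 * (?C * ?B\<^sup>2)\<^sup>2 * ?r ^ 4 + ?C * \<kappa> / (1 - \<rho>) * ?B\<^sup>2 * ?r ^ 4"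
    by (simp only: loss_gain_def distrib_right)
  finally have "E / 2 * (?C * ?B\<^sup>2)\<^sup>2 * ?r ^ 4 + ?C * \<kappa> / (1 - \<rho>) * ?B\<^sup>2 * ?r ^ 4
      \<le> 8 * loss_const * (excess_of S + (1 + quiet_level (\<beta> * wmax)))" .
  then show ?thesis
    unfolding batch_charge_def using squares benign by linarith
qed

lemma benchmark_increment_play:
  assumes S: "valid S" "stage_of S \<le> T" and i: "i \<in> active_of S"
  shows "benchmark_cost istar (stage_of S + min \<tau> (Suc T - stage_of S))
      + cost_const * state_const\<^sup>2 * real \<tau> * real (unstable (play S i))
    \<le> benchmark_cost istar (stage_of (play S i))
      + cost_const * state_const\<^sup>2 * real \<tau> * real (unstable S)"
  using assms
proof (cases rule: play_cases)
  case removed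
  let ?l = "min \<tau> (Suc T - stage_of S)"
  have "benchmark_cost istar (stage_of S + ?l) - benchmark_cost istar (stage_of S)
      \<le> real ?l * (cost_const * state_const\<^sup>2)"
    by (rule benchmark_cost_increment_le[OF istar])
  also have "\<dots> \<le> real \<tau> * (cost_const * state_const\<^sup>2)"
    using cost_const_nonneg by (intro mult_right_mono) auto
  finally have "benchmark_cost istar (stage_of S + ?l) - benchmark_cost istar (stage_of S)
      \<le> cost_const * state_const\<^sup>2 * real \<tau>"
    by (simp add: mult_ac)
  moreover have "benchmark_cost istar (stage_of S) \<le> benchmark_cost istar (stage_of (play S i))"
    using removed by (intro benchmark_cost_mono istar_facts) auto
  moreover have "cost_const * state_const\<^sup>2 * real \<tau> * real (unstable S)
      = cost_const * state_const\<^sup>2 * real \<tau> + cost_const * state_const\<^sup>2 * real \<tau> * real (unstable (play S i))"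
    by (simp add: distrib_left flip: removed(1))
  ultimately show ?thesis
    by linarith
qed simp

text \<open>
  The fourth power of the state splits into a constant, paid by the batch that is used up, and the
  excess, paid by the burst potential.
\<close>

lemma budget_play:
  assumes S: "valid S" "stage_of S \<le> T" and i: "i \<in> active_of S"
  shows "budget (play S i) + batch_charge S \<le> budget S"
proof -
  let ?z = "1 + quiet_level (\<beta> * wmax)"
  have "burst_left (play S i) + ?z * batches_left (play S i) + (excess_of S + ?z)
      \<le> burst_left S + ?z * batches_left S"
    using burst_left_play[OF assms] mult_left_mono[OF batches_left_play[OF assms], of ?z]
      quiet_level_nonneg[of "\<beta> * wmax"] by (simp add: algebra_simps)
  then have "8 * loss_const * (burst_left (play S i) + ?z * batches_left (play S i) + (excess_of S + ?z))
      \<le> 8 * loss_const * (burst_left S + ?z * batches_left S)"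
    using loss_const_nonneg by (intro mult_left_mono) auto
  then have "8 * loss_const * (burst_left (play S i) + ?z * batches_left (play S i))
      + 8 * loss_const * (excess_of S + ?z) \<le> 8 * loss_const * (burst_left S + ?z * batches_left S)"
    by (simp only: distrib_left)
  then show ?thesis
    unfolding budget_def using batch_charge_le[OF S] benchmark_increment_play[OF assms] by linarith
qed

text \<open>
  On every outcome the incurred cost cancels against the first-order decrease of the weights. The
  two terms that remain carry the factor \<open>1 / p\<close>, so that in expectation each of them becomes the
  loss itself.
\<close>

lemma exp3_potential_play:
  assumes S: "valid S" "stage_of S \<le> T" and i: "i \<in> active_of S"
  shows "exp3_potential (play S i) \<le> exp3_potential S
    + (\<eta> / (2 * real \<tau>) * (arm_cost S i)\<^sup>2 + (if i = istar then arm_cost S i else 0))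
      / pmf (sampler_of S) i"
proof -
  note v = validD[OF S(1)]
  let ?b = "arm_cost S i" and ?p = "pmf (sampler_of S) i"
  have A': "active_of (play S i) \<subseteq> active_of S" "active_of (play S i) \<noteq> {}"
    using validD[OF valid_play[OF assms]] by (auto simp: play_simps split: if_splits)
  have b: "0 \<le> ?b"
    using i v by (intro batch_sum_nonneg) auto
  have "log_weight \<eta> (estimate_of (play S i)) (active_of (play S i))
      \<le> log_weight \<eta> (estimate_of S) (active_of S) - ?b / real \<tau> + \<eta> / 2 * ((?b / real \<tau>)\<^sup>2 / ?p)"
    using log_weight_importance_weighted_step[OF v(2) i A' \<eta>, of "?b / real \<tau>" "estimate_of S"] b
    unfolding play_simps(4) v(6) by simp
  then have "real \<tau> * log_weight \<eta> (estimate_of (play S i)) (active_of (play S i))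
      \<le> real \<tau> * (log_weight \<eta> (estimate_of S) (active_of S) - ?b / real \<tau> + \<eta> / 2 * ((?b / real \<tau>)\<^sup>2 / ?p))"
    by (intro mult_left_mono) auto
  also have "\<dots> = real \<tau> * log_weight \<eta> (estimate_of S) (active_of S) - ?b + \<eta> / (2 * real \<tau>) * ?b\<^sup>2 / ?p"
    using \<tau> by (simp add: power2_eq_square algebra_simps)
  finally have "real \<tau> * log_weight \<eta> (estimate_of (play S i)) (active_of (play S i))
      \<le> real \<tau> * log_weight \<eta> (estimate_of S) (active_of S) - ?b + \<eta> / (2 * real \<tau>) * ?b\<^sup>2 / ?p" .
  moreover have "real \<tau> * estimate_of (play S i) istar
      = real \<tau> * estimate_of S istar + (if i = istar then ?b else 0) / ?p"
    using \<tau> by (auto simp: play_simps distrib_left)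
  ultimately show ?thesis
    unfolding exp3_potential_def by (simp add: play_simps(6) distrib_left add_divide_distrib)
qed

definition regret_potential :: "exp3_state \<Rightarrow> real" where
  "regret_potential S = exp3_potential S + budget S"

text \<open>
  Drawing from the exponential weights turns the importance-weighted terms of the EXP3 potential
  into the charge of the batch, which the budget pays on every outcome.
\<close>

lemma regret_potential_play:
  assumes S: "valid S" "stage_of S \<le> T"
  shows "measure_pmf.expectation (sampler_of S) (\<lambda>i. regret_potential (play S i)) \<le> regret_potential S"
proof -
  note v = validD[OF S(1)]
  let ?A = "active_of S" and ?p = "pmf (sampler_of S)"
  let ?loss = "\<lambda>i. \<eta> / (2 * real \<tau>) * (arm_cost S i)\<^sup>2 + (if i = istar then arm_cost S i else 0)"
  have set: "set_pmf (sampler_of S) = ?A"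
    unfolding v(6) by (rule set_pmf_exp_weights[OF v(2,5)])
  have total: "(\<Sum>i\<in>?A. ?p i) = 1"
    using sum_pmf_eq_1[OF v(2)] set by simp
  have p: "0 < ?p i" if "i \<in> ?A" for i
    using that set by (simp add: pmf_positive)
  have "measure_pmf.expectation (sampler_of S) (\<lambda>i. regret_potential (play S i))
      = (\<Sum>i\<in>?A. regret_potential (play S i) * ?p i)"
    using v(2) set by (intro integral_measure_pmf_real) auto
  also have "\<dots> \<le> (\<Sum>i\<in>?A. (regret_potential S - batch_charge S) * ?p i + ?loss i)"
  proof (rule sum_mono)
    fix i assume i: "i \<in> ?A"
    have "regret_potential (play S i) \<le> regret_potential S - batch_charge S + ?loss i / ?p i"
      using exp3_potential_play[OF S i] budget_play[OF S i] by (simp add: regret_potential_def)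
    then have "regret_potential (play S i) * ?p i
        \<le> (regret_potential S - batch_charge S + ?loss i / ?p i) * ?p i"
      by (intro mult_right_mono) auto
    also have "\<dots> = (regret_potential S - batch_charge S) * ?p i + ?loss i"
      using p[OF i] by (simp only: distrib_right) simp
    finally show "regret_potential (play S i) * ?p i
        \<le> (regret_potential S - batch_charge S) * ?p i + ?loss i" .
  qed
  also have "\<dots> = (regret_potential S - batch_charge S) + batch_charge S"
    using v(2,4) total
    by (simp add: sum.distrib batch_charge_def flip: sum_distrib_left)
  finally show ?thesis
    by simp
qed

lemma set_pmf_batch:
  assumes "valid S"
  shows "finite (set_pmf (exp3_iss_batch (\<lambda>_. \<eta>) \<tau> T S))"
    and "S' \<in> set_pmf (exp3_iss_batch (\<lambda>_. \<eta>) \<tau> T S) \<Longrightarrow> valid S'"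
proof -
  note v = validD[OF assms]
  have set: "set_pmf (sampler_of S) = active_of S"
    unfolding v(6) by (rule set_pmf_exp_weights[OF v(2,5)])
  show "finite (set_pmf (exp3_iss_batch (\<lambda>_. \<eta>) \<tau> T S))"
    using v set by (simp add: exp3_iss_batch_def)
  show "S' \<in> set_pmf (exp3_iss_batch (\<lambda>_. \<eta>) \<tau> T S) \<Longrightarrow> valid S'"
    using assms v set valid_play[OF assms] by (auto simp: exp3_iss_batch_def not_less split: if_splits)
qed

lemma finite_run: "finite (set_pmf (run j))"
  and valid_run: "S \<in> set_pmf (run j) \<Longrightarrow> valid S"
proof (induction j arbitrary: S)
  case 0
  {
    case 1
    show ?case by simp
  next
    case 2
    have "pmf_of_set {1..N} = exp_weights \<eta> (\<lambda>_. 0) {1..N}"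
      using istar_facts(1) by (intro exp_weights_zero[symmetric]) auto
    then show ?case
      using 2 x0 istar_facts(1) by (simp add: valid_def)
  }
next
  case (Suc j)
  {
    case 1
    show ?case
      using Suc.IH set_pmf_batch by auto
  next
    case 2
    then show ?case
      using Suc.IH set_pmf_batch by auto
  }
qed

lemma expectation_regret_potential:
  "measure_pmf.expectation (run j) regret_potential
    \<le> measure_pmf.expectation (run 0) regret_potential"
proof (induction j)
  case (Suc j)
  have "measure_pmf.expectation (run (Suc j)) regret_potential
      \<le> measure_pmf.expectation (run j) regret_potential"
    unfolding exp3_iss.simps(2)
  proof (rule expectation_bind_pmf_le)
    fix S assume "S \<in> set_pmf (run j)"
    then have S: "valid S"
      by (rule valid_run)
    show "finite (set_pmf (exp3_iss_batch (\<lambda>_. \<eta>) \<tau> T S))"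
      by (rule set_pmf_batch(1)[OF S])
    show "measure_pmf.expectation (exp3_iss_batch (\<lambda>_. \<eta>) \<tau> T S) regret_potential \<le> regret_potential S"
      using regret_potential_play[OF S] by (simp add: exp3_iss_batch_def not_less)
  qed (rule finite_run)
  with Suc.IH show ?case
    by simp
qed simp

text \<open>
  The weight of the comparator alone keeps the EXP3 potential above the cost, and all parts of the
  budget are nonnegative except for the benchmark.
\<close>

lemma cost_le_regret_potential:
  assumes S: "valid S"
  shows "cost_of S \<le> regret_potential S + controller_cost T istar"
proof -
  note v = validD[OF S]
  have "- estimate_of S istar \<le> log_weight \<eta> (estimate_of S) (active_of S)"
    using v \<eta> by (intro log_weight_ge) auto
  then have "0 \<le> real \<tau> * (log_weight \<eta> (estimate_of S) (active_of S) + estimate_of S istar)"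
    by (intro mult_nonneg_nonneg) auto
  moreover have "benchmark_cost istar (stage_of S) \<le> controller_cost T istar"
  proof -
    have "benchmark_cost istar (stage_of S) \<le> benchmark_cost istar (Suc T)"
      using S by (intro benchmark_cost_mono istar_facts) (simp add: valid_def)
    then show ?thesis
      by (simp add: benchmark_cost_def controller_cost_def lessThan_Suc_atMost)
  qed
  moreover have "0 \<le> burst_left S"
  proof -
    have "0 \<le> burst_potential K W b r" for K W b r
      using burst_potential_ge[of W r K b] excess_nonneg[of W r] by linarith
    then show ?thesis
      by (simp add: burst_left_def)
  qed
  moreover have "0 \<le> batches_left S"
    by (simp add: batches_left_def)
  ultimately show ?thesis
    using loss_const_nonneg quiet_level_nonneg[of "\<beta> * wmax"] cost_const_nonneg
    by (simp add: regret_potential_def exp3_potential_def budget_def add_increasing)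
qed

lemma regret_le:
  "exp3_iss_cost (\<lambda>_. \<eta>) \<tau> T - controller_cost T istar \<le>
     real \<tau> * (ln (real N) / \<eta>)
     + cost_const * state_const\<^sup>2 * real \<tau> * real num_not_E_ISS
     + 8 * loss_const *
       (burst_potential (2 * Lf * control_const * state_const) (\<beta> * wmax) num_not_E_ISS (enorm n x0)
        + (1 + quiet_level (\<beta> * wmax)) * (real num_not_E_ISS + (real (Suc T) / real \<tau> + 1)))"
proof -
  let ?R = "run (Suc T)"
  have int: "integrable (measure_pmf ?R) (h :: _ \<Rightarrow> real)" for h
    by (rule integrable_measure_pmf_finite[OF finite_run])
  have "exp3_iss_cost (\<lambda>_. \<eta>) \<tau> T
      \<le> measure_pmf.expectation ?R (\<lambda>S. regret_potential S + controller_cost T istar)"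
    unfolding exp3_iss_cost_def
  proof (intro integral_mono_AE int)
    show "AE S in measure_pmf ?R. cost_of S \<le> regret_potential S + controller_cost T istar"
      unfolding AE_measure_pmf_iff by (intro ballI cost_le_regret_potential valid_run)
  qed
  also have "\<dots> = measure_pmf.expectation ?R regret_potential + controller_cost T istar"
    by (subst Bochner_Integration.integral_add[OF int int]) simp
  also have "\<dots> \<le> measure_pmf.expectation (run 0) regret_potential + controller_cost T istar"
    using expectation_regret_potential[of "Suc T"] by (rule add_right_mono)
  finally have "exp3_iss_cost (\<lambda>_. \<eta>) \<tau> T - controller_cost T istar
      \<le> measure_pmf.expectation (run 0) regret_potential"
    by simp
  then show ?thesis
    by (simp add: regret_potential_def exp3_potential_def budget_def log_weight_zero benchmark_cost_def
        unstable_def num_not_E_ISS_def burst_left_def batches_left_def)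
qed

end

section \<open>Choice of the parameters\<close>

lemma batch_parameter_bounds:
  fixes \<kappa> \<rho> :: real and N T :: nat
  assumes \<kappa>: "1 \<le> \<kappa>" and \<rho>: "0 < \<rho>" "\<rho> < 1" and N: "0 < N" "N \<le> T"
  defines "q \<equiv> real T powr (1/3) / real N powr (1/3)"
    and "l \<equiv> ln (2 * sqrt 2 * \<kappa>) / (- ln \<rho>)"
    and "\<tau> \<equiv> batch_parameter \<kappa> \<rho> N T"
  shows "0 < \<tau>" "q \<le> real \<tau>" "real \<tau> \<le> (l + 2) * q" "\<kappa> * \<rho> ^ \<tau> \<le> 1 / (2 * sqrt 2)"
proof -
  have q1: "1 \<le> q"
    using N unfolding q_def by (subst le_divide_eq_1_pos) (auto intro: powr_mono2)
  have "real N powr (-1/3) = 1 / real N powr (1/3)"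
    using powr_minus_divide[of "real N" "1/3"] by simp
  then have \<tau>: "\<tau> = nat \<lceil>max q l\<rceil>"
    by (simp add: \<tau>_def batch_parameter_def q_def l_def)
  have ln\<rho>: "ln \<rho> < 0"
    using \<rho> by simp
  have "1 \<le> sqrt (2 :: real)"
    by simp
  then have "1 * 1 \<le> 2 * sqrt 2 * \<kappa>"
    using \<kappa> by (intro mult_mono) linarith+
  then have one: "1 \<le> 2 * sqrt 2 * \<kappa>"
    by simp
  then have pos: "0 < 2 * sqrt 2 * \<kappa>"
    by linarith
  have l0: "0 \<le> l"
    using one ln\<rho> unfolding l_def by (intro divide_nonneg_pos) auto
  have lower: "max q l \<le> real \<tau>"
    unfolding \<tau> by linarith
  then show "q \<le> real \<tau>" "0 < \<tau>"
    using q1 by auto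
  have "real \<tau> \<le> max q l + 1"
    unfolding \<tau> using q1 by linarith
  also have "\<dots> \<le> (q + l) + 1"
    using q1 l0 by simp
  also have "\<dots> \<le> (l + 2) * q"
    using q1 mult_left_mono[OF q1 l0] by (simp add: algebra_simps)
  finally show "real \<tau> \<le> (l + 2) * q" .
  have "l * (- ln \<rho>) \<le> real \<tau> * (- ln \<rho>)"
    using lower ln\<rho> by (intro mult_right_mono) auto
  then have "real \<tau> * ln \<rho> \<le> - ln (2 * sqrt 2 * \<kappa>)"
    using ln\<rho> by (simp add: l_def)
  then have "exp (real \<tau> * ln \<rho>) \<le> exp (- ln (2 * sqrt 2 * \<kappa>))"
    by simp
  also have "exp (real \<tau> * ln \<rho>) = \<rho> ^ \<tau>"
    using \<rho> by (simp add: exp_of_nat_mult)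
  also have "exp (- ln (2 * sqrt 2 * \<kappa>)) = 1 / (2 * sqrt 2 * \<kappa>)"
    by (simp only: exp_minus exp_ln[OF pos] inverse_eq_divide)
  finally have "\<kappa> * \<rho> ^ \<tau> \<le> \<kappa> * (1 / (2 * sqrt 2 * \<kappa>))"
    using \<kappa> by (intro mult_left_mono) auto
  then show "\<kappa> * \<rho> ^ \<tau> \<le> 1 / (2 * sqrt 2)"
    using \<kappa> by simp
qed

text \<open>
  For \<open>k = 0\<close> the factor \<open>X\<close> cannot be absorbed into the exponential, hence the extra summand.
\<close>

lemma mult_power_le_add_exp:
  fixes X A :: real
  assumes X: "1 \<le> X" and A: "1 \<le> A"
  shows "X * A ^ k \<le> X + exp (ln (X * A) * real k)"
proof (cases "k = 0")
  case False
  have "X ^ 1 \<le> X ^ k"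
    using X False by (intro power_increasing) auto
  then have "X * A ^ k \<le> (X * A) ^ k"
    using A by (simp add: power_mult_distrib mult_right_mono)
  also have "\<dots> = exp (ln (X * A) * real k)"
    using mult_mono[of 1 X 1 A] X A exp_of_nat2_mult[of "ln (X * A)" k] by simp
  finally show ?thesis
    using X by simp
qed simp

text \<open>
  To be read with \<open>u = N\<^bsup>1/3\<^esup>\<close> and \<open>v = T\<^bsup>1/3\<^esup>\<close>, so that the target rate is \<open>u v\<^sup>2\<close>: \<open>\<tau>\<close> is
  of order \<open>v / u\<close> and \<open>\<eta>\<close> of order \<open>1 / (u\<^sup>2 v)\<close>. The lower-order terms fit because
  \<open>N \<le> T\<close>, i.e. \<open>u \<le> v\<close>.
\<close>

lemma regret_rate:
  fixes \<tau> \<eta> a h u v l M :: real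
  assumes a: "0 < a" and u: "1 \<le> u" "u \<le> v" and l: "0 \<le> l" and M: "0 \<le> M" "M \<le> u ^ 3"
    and \<tau>: "v / u \<le> \<tau>" "\<tau> \<le> l * (v / u)" and \<eta>: "a / (u\<^sup>2 * v) \<le> \<eta>" and h: "0 \<le> h"
  shows "\<tau> * (h / \<eta>) \<le> l / a * h * (u * v\<^sup>2)"
    and "\<tau> * M \<le> l * (u * v\<^sup>2)"
    and "M + ((v ^ 3 + 1) / \<tau> + 1) \<le> 4 * (u * v\<^sup>2)"
proof -
  have uv: "0 < u" "0 < v" "1 \<le> v"
    using u by auto
  have \<tau>0: "0 < \<tau>"
    using \<tau>(1) uv by (smt (verit) divide_pos_pos)
  have "h / \<eta> \<le> h / (a / (u\<^sup>2 * v))"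
    using h \<eta> a uv by (intro divide_left_mono mult_pos_pos) (auto intro: less_le_trans[OF _ \<eta>])
  then have "\<tau> * (h / \<eta>) \<le> (l * (v / u)) * (h / (a / (u\<^sup>2 * v)))"
    using \<tau> \<tau>0 h a uv l \<eta> by (intro mult_mono) (auto intro!: divide_nonneg_nonneg intro: order_trans[OF _ \<eta>])
  also have "\<dots> = l / a * h * (u * v\<^sup>2)"
    using uv a by (simp add: field_simps power2_eq_square)
  finally show "\<tau> * (h / \<eta>) \<le> l / a * h * (u * v\<^sup>2)" .
  have "u ^ 3 = u * u\<^sup>2"
    by (simp add: power2_eq_square power3_eq_cube)
  also have "\<dots> \<le> u * v\<^sup>2"
    using u by (intro mult_left_mono power_mono) auto
  finally have u3: "u ^ 3 \<le> u * v\<^sup>2" .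
  have "\<tau> * M \<le> l * (v / u) * u ^ 3"
    using \<tau> M \<tau>0 l uv by (intro mult_mono) auto
  also have "\<dots> = l * (u * (u * v))"
    using uv by (simp add: field_simps power3_eq_cube)
  also have "\<dots> \<le> l * (u * (v * v))"
    using u l by (intro mult_left_mono mult_right_mono) auto
  finally show "\<tau> * M \<le> l * (u * v\<^sup>2)"
    by (simp add: power2_eq_square)
  have "(v ^ 3 + 1) / \<tau> \<le> (v ^ 3 + v ^ 3) / (v / u)"
    using \<tau> \<tau>0 uv by (intro frac_le add_left_mono) auto
  also have "\<dots> = 2 * (u * v\<^sup>2)"
    using uv by (simp add: field_simps power2_eq_square power3_eq_cube)
  finally have "(v ^ 3 + 1) / \<tau> \<le> 2 * (u * v\<^sup>2)" .
  moreover have "1 \<le> u ^ 3"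
    using u by simp
  ultimately show "M + ((v ^ 3 + 1) / \<tau> + 1) \<le> 4 * (u * v\<^sup>2)"
    using u3 M by linarith
qed

theorem corollary11:
  fixes Lf L\<pi> \<pi>bar Lc1 Lc2 c0 \<kappa> \<rho> W r0 a b :: real
  assumes "0 < a" and "a \<le> b"
  shows "\<exists>C>0. \<exists>D>0.
    \<forall>n m f N \<pi> wmax \<beta> w c x0 T \<eta>.
      switching_control n m f N \<pi> wmax \<kappa> \<rho> \<beta> w c x0 Lf L\<pi> \<pi>bar Lc1 Lc2 c0 \<longrightarrow>
      \<beta> * wmax = W \<longrightarrow> enorm n x0 = r0 \<longrightarrow> N \<le> T \<longrightarrow>
      a / (real N powr (2/3) * real T powr (1/3)) \<le> \<eta> \<longrightarrow>
      \<eta> \<le> b / (real N powr (2/3) * real T powr (1/3)) \<longrightarrow>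
      switching_control.policy_regret n f N \<pi> wmax \<kappa> \<rho> \<beta> w c x0
          (\<lambda>_. \<eta>) (batch_parameter \<kappa> \<rho> N T) T
        \<le> C * (1 + ln (real N)) * real N powr (1/3) * real T powr (2/3)
          + exp (D * real (switching_control.num_not_E_ISS n f N \<pi> wmax \<kappa> \<rho> \<beta>))"
proof -
  \<comment> \<open>\<open>l\<close> bounds \<open>\<tau>\<close> in units of \<open>(T / N)\<^bsup>1/3\<^esup>\<close>, hence \<open>l b\<close> bounds \<open>\<tau> \<eta> N\<close>.\<close>
  define l where "l = ln (2 * sqrt 2 * \<kappa>) / (- ln \<rho>) + 2"
  define B where "B = state_gain \<kappa> W r0"
  define K where "K = cost_gain L\<pi> \<pi>bar Lc1 Lc2 c0"
  define J where "J = 2 * Lf * control_gain L\<pi> \<pi>bar * B"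
  define G where "G = loss_gain K B \<kappa> \<rho> (l * b)"
  define X where "X = max 1 (8 * G * (2 * excess W r0 + 1))"
  define A where "A = burst_rate J W"
  \<comment> \<open>The lower bound 1 keeps \<open>C\<close> positive also for parameters that no system satisfies.\<close>
  define C where "C = max 1 (l / a + K * B\<^sup>2 * l + X + 8 * G * (1 + quiet_level W) * 4)"
  define D where "D = ln (X * A)"
  have X1: "1 \<le> X" and A2: "2 \<le> A"
    using burst_rate_ge by (auto simp: X_def A_def)
  then have "1 * 2 \<le> X * A"
    by (intro mult_mono) auto
  then have D: "0 < D"
    unfolding D_def by simp
  have C: "0 < C"
    by (simp add: C_def)
  have bound: "switching_control.policy_regret n f N \<pi> wmax \<kappa> \<rho> \<beta> w c x0
          (\<lambda>_. \<eta>) (batch_parameter \<kappa> \<rho> N T) T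
        \<le> C * (1 + ln (real N)) * real N powr (1/3) * real T powr (2/3)
          + exp (D * real (switching_control.num_not_E_ISS n f N \<pi> wmax \<kappa> \<rho> \<beta>))"
    if sc: "switching_control n m f N \<pi> wmax \<kappa> \<rho> \<beta> w c x0 Lf L\<pi> \<pi>bar Lc1 Lc2 c0"
      and W: "\<beta> * wmax = W" and r0: "enorm n x0 = r0" and NT: "N \<le> T"
      and \<eta>: "a / (real N powr (2/3) * real T powr (1/3)) \<le> \<eta>"
        "\<eta> \<le> b / (real N powr (2/3) * real T powr (1/3))"
    for n m f N \<pi> wmax \<beta> w c x0 T \<eta>
  proof -
    interpret switching_control n m f N \<pi> wmax \<kappa> \<rho> \<beta> w c x0 Lf L\<pi> \<pi>bar Lc1 Lc2 c0
      by (rule sc)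
    define \<tau> where "\<tau> = batch_parameter \<kappa> \<rho> N T"
    define M where "M = num_not_E_ISS"
    have "finite benign"
      by (simp add: benign_def)
    moreover have "benign \<noteq> {}"
      using benign_nonempty by (simp add: benign_def)
    ultimately have "(MIN i\<in>benign. controller_cost T i) \<in> controller_cost T ` benign"
      by (intro Min_in) auto
    then obtain istar where istar: "istar \<in> benign"
      and best: "(MIN i\<in>benign. controller_cost T i) = controller_cost T istar"
      by auto
    have N0: "0 < N"
      using benignD(1)[OF istar] by simp
    define u v where "u = real N powr (1/3)" and "v = real T powr (1/3)"
    have u1: "1 \<le> u" and uv: "u \<le> v"
      using N0 NT by (auto simp: u_def v_def intro!: ge_one_powr_ge_zero powr_mono2)
    have pow: "real N = u ^ 3" "real N powr (2/3) = u\<^sup>2" "real T = v ^ 3" "real T powr (2/3) = v\<^sup>2"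
      using N0 NT by (auto simp: u_def v_def powr_powr simp flip: powr_realpow)
    have \<tau>_bounds: "0 < \<tau>" "v / u \<le> real \<tau>" "real \<tau> \<le> l * (v / u)" "\<kappa> * \<rho> ^ \<tau> \<le> 1 / (2 * sqrt 2)"
      using batch_parameter_bounds[OF \<kappa> \<rho> N0 NT] by (auto simp: l_def \<tau>_def u_def v_def)
    have \<eta>_bounds: "a / (u\<^sup>2 * v) \<le> \<eta>" "\<eta> \<le> b / (u\<^sup>2 * v)"
      using \<eta> by (simp_all only: pow(2) v_def)
    have "0 < a / (u\<^sup>2 * v)"
      using assms u1 uv by simp
    with \<eta>_bounds(1) have \<eta>_pos: "0 < \<eta>"
      by linarith
    have "0 < v / u"
      using u1 uv by simp
    then have l0: "0 \<le> l"
      using \<tau>_bounds(1,3) by (smt (verit) mult_nonpos_nonneg of_nat_0_less_iff)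
    have "real \<tau> * \<eta> * real N \<le> (l * (v / u)) * (b / (u\<^sup>2 * v)) * real N"
      using \<tau>_bounds(3) \<eta>_bounds \<eta>_pos by (intro mult_right_mono mult_mono) auto
    also have "\<dots> = l * b"
      using u1 uv by (simp add: pow field_simps power2_eq_square power3_eq_cube)
    finally have step: "real \<tau> * \<eta> * real N \<le> l * b" .
    interpret exp3_iss_run n m f N \<pi> wmax \<kappa> \<rho> \<beta> w c x0 Lf L\<pi> \<pi>bar Lc1 Lc2 c0 istar \<eta> \<tau> T "l * b"
      by unfold_locales (use istar \<eta>_pos \<tau>_bounds step in auto)
    define R where "R = u * v\<^sup>2"
    have "M \<le> card {1..N}"
      unfolding M_def num_not_E_ISS_def by (intro card_mono) auto
    then have M: "real M \<le> u ^ 3"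
      by (simp flip: pow(1))
    have h: "0 \<le> ln (real N)"
      using N0 by simp
    note rate = regret_rate[OF assms(1) u1 uv l0 of_nat_0_le_iff M \<tau>_bounds(2,3) \<eta>_bounds(1) h, folded R_def]
    have R1: "1 \<le> R"
      using u1 uv mult_mono[of 1 u 1 "v\<^sup>2"] by (simp add: R_def)
    have G0: "0 \<le> G" and K0: "0 \<le> K"
      using loss_const_nonneg cost_const_nonneg by (simp_all add: G_def K_def B_def W r0)
    have "policy_regret (\<lambda>_. \<eta>) \<tau> T
        \<le> real \<tau> * (ln (real N) / \<eta>) + K * B\<^sup>2 * real \<tau> * real M
          + 8 * G * (A ^ M * (2 * excess W r0 + 1)
            + (1 + quiet_level W) * (real M + (real (Suc T) / real \<tau> + 1)))"
      using regret_le
      by (simp add: policy_regret_def best W r0 burst_potential_def K_def B_def G_def A_def J_def M_def)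
    also have "\<dots> = real \<tau> * (ln (real N) / \<eta>) + K * B\<^sup>2 * (real \<tau> * real M)
          + 8 * G * (2 * excess W r0 + 1) * A ^ M
          + 8 * G * (1 + quiet_level W) * (real M + ((v ^ 3 + 1) / real \<tau> + 1))"
    proof -
      have "real (Suc T) = v ^ 3 + 1"
        by (simp flip: pow(3))
      then show ?thesis
        by (simp only: distrib_left distrib_right mult_ac add_ac)
    qed
    also have "\<dots> \<le> l / a * ln (real N) * R + K * B\<^sup>2 * (l * R)
          + (X + exp (D * real M)) + 8 * G * (1 + quiet_level W) * (4 * R)"
    proof (intro add_mono mult_left_mono rate)
      have "8 * G * (2 * excess W r0 + 1) * A ^ M \<le> X * A ^ M"
        using A2 by (intro mult_right_mono) (auto simp: X_def)
      also have "\<dots> \<le> X + exp (D * real M)"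
        using mult_power_le_add_exp[of X A M] X1 A2 by (simp add: D_def)
      finally show "8 * G * (2 * excess W r0 + 1) * A ^ M \<le> X + exp (D * real M)" .
    qed (use G0 K0 quiet_level_nonneg[of W] in auto)
    also have "\<dots> \<le> C * (1 + ln (real N)) * R + exp (D * real M)"
    proof -
      let ?rest = "K * B\<^sup>2 * l + X + 8 * G * (1 + quiet_level W) * 4"
      have rest: "0 \<le> ?rest"
        using G0 K0 l0 X1 quiet_level_nonneg[of W] by simp
      have la: "0 \<le> l / a"
        using l0 assms by simp
      have "X * 1 \<le> X * R"
        using X1 R1 by (intro mult_left_mono) auto
      then have "l / a * ln (real N) * R + K * B\<^sup>2 * (l * R) + X + 8 * G * (1 + quiet_level W) * (4 * R)
          \<le> (l / a * ln (real N) + ?rest) * R"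
        by (simp add: algebra_simps)
      also have "\<dots> \<le> (C * (1 + ln (real N))) * R"
      proof (rule mult_right_mono)
        have "l / a * ln (real N) + ?rest \<le> (l / a + ?rest) * (1 + ln (real N))"
          using mult_nonneg_nonneg[OF rest h] la by (simp add: algebra_simps)
        also have "\<dots> \<le> C * (1 + ln (real N))"
          using h by (intro mult_right_mono) (auto simp: C_def)
        finally show "l / a * ln (real N) + ?rest \<le> C * (1 + ln (real N))" .
      qed (use R1 in auto)
      finally show ?thesis
        by simp
    qed
    finally show ?thesis
      unfolding pow(4) R_def \<tau>_def M_def u_def[symmetric] by (simp add: mult.assoc)
  qed
  show ?thesis
    using C D bound by blast
qed

end
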